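(* Let $\ell>r\ge 2$ be integers, let $m=m_{r,\ell}$, and let $F=K_{a_1,\ldots,a_r}$ (with $a_1\ge\cdots\ge a_r\ge1$) be an almost balanced complete $r$-partite graph on $\ell=a_1+\cdots+a_r$ vertices. Then \[ \mathrm{OPT}_{k+1}(F)=\begin{cases}\{\bm{k}\}, & \text{if } k\in[r,m-1],\\ \{\bm{m}\}, & \text{if } k\in[m,\infty],\end{cases} \] where $k=\infty$ means $\mathrm{OPT}_\infty(F)=\mathrm{OPT}(F)$. In particular, the maximum of $p_F$ over $\mathbb{S}^{k-1}$ (over $\overline{\mathcal{P}}$ when $k=\infty$) equals $\kappa_F\cdot\frac{(k-1)_{r-1}}{k^{\ell-1}}$ if $k\in[r,m-1]$ and $\kappa_F\cdot\frac{(m-1)_{r-1}}{m^{\ell-1}}$ if $k\in[m,\infty]$.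
   Context: $F=K_{a_1,\ldots,a_r}$ is the complete $r$-partite graph with part sizes $a_1\ge\cdots\ge a_r\ge 1$; it is almost balanced if it is not complete and $\binom{a_1-a_r}{2}<a_r$. Let $\mathrm{sc}(F)$ be the number of parts of size one (these are $a_{r-\mathrm{sc}(F)+1},\ldots,a_r$). For integers $z$, $(z)_k=z(z-1)\cdots(z-k+1)$ if $z>k-1$ and $0$ otherwise. $\kappa_F=\frac{\ell!}{a_1!\cdots a_r!\,\mathrm{sym}(a_1,\ldots,a_r)}$ where $\mathrm{sym}(a_1,\ldots,a_r)=r_1!\cdots r_t!$ if the distinct values among the $a_i$ have multiplicities $r_1,\ldots,r_t$. $m_{r,\ell}$ is the unique integer $k\ge r$ maximizing $f(k)=\frac{(k-1)\cdots(k-r+1)}{k^{\ell-1}}$ over integers $k\ge r$. Let $\overline{\mathcal{P}}=\{(x_1,x_2,\ldots)\in\mathbb{R}^{\mathbb{N}_+}: x_1\ge x_2\ge\cdots\ge 0,\ \sum_i x_i\le 1\}$, and for $\bm{x}\in\overline{\mathcal{P}}$ set $x_0=1-\sum_{i\ge1}x_i$. For positive integers $d_1,\ldots,d_t$ let $S_{d_1,\ldots,d_t}(\bm{x})=\sum x_{i_1}^{d_1}\cdots x_{i_t}^{d_t}$, summed over all ordered $t$-tuples $(i_1,\ldots,i_t)$ of pairwise distinct positive integers, with $S_\varnothing=1$. Define $p_F(\bm{x})=\kappa_F\sum_{i=0}^{\mathrm{sc}(F)}\binom{\mathrm{sc}(F)}{i}x_0^i\,S_{a_1,\ldots,a_{r-i}}(\bm{x})$.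 For an integer $k\ge1$, $\mathbb{S}^{k-1}=\{(x_1,\ldots,x_k,0,0,\ldots): x_i\ge 0,\ x_1+\cdots+x_k=1\}$, and $\bm{k}=(1/k,\ldots,1/k,0,\ldots)$ with $k$ entries equal to $1/k$. $\mathrm{OPT}_{k+1}(F)$ is the set of $\bm{x}\in\mathbb{S}^{k-1}$ with $p_F(\bm{x})=\max_{\bm{y}\in\mathbb{S}^{k-1}}p_F(\bm{y})$ (points of $\mathbb{S}^{k-1}$ are considered up to reordering entries into non-increasing order, so that $\mathbb{S}^{k-1}\subseteq\overline{\mathcal{P}}$), and $\mathrm{OPT}(F)$ is the set of $\bm{x}\in\overline{\mathcal{P}}$ with $p_F(\bm{x})=\max_{\bm{y}\in\overline{\mathcal{P}}}p_F(\bm{y})$. *)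

theory Defs
  imports "HOL-Analysis.Analysis"
begin

text \<open>Part sizes of F = K_{a_1,...,a_r} are given as a list a = [a_1,...,a_r].
  Sequences x_1, x_2, ... are represented as x :: nat => real with x i standing for x_{i+1}.\<close>

definition ell :: "nat list \<Rightarrow> nat" where
  "ell a = sum_list a"

definition valid_parts :: "nat list \<Rightarrow> bool" where
  "valid_parts a \<longleftrightarrow> sorted_wrt (\<ge>) a \<and> (\<forall>v\<in>set a. v \<ge> 1)"

definition is_complete :: "nat list \<Rightarrow> bool" where
  "is_complete a \<longleftrightarrow> (\<forall>v\<in>set a. v = 1)"

definition almost_balanced :: "nat list \<Rightarrow> bool" where
  "almost_balanced a \<longleftrightarrow> \<not> is_complete a \<and> (hd a - last a) choose 2 < last a"

definition sc :: "nat list \<Rightarrow> nat" where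
  "sc a = length (filter (\<lambda>v. v = 1) a)"

definition falling :: "int \<Rightarrow> nat \<Rightarrow> real" where
  "falling z k = (if z > int k - 1 then (\<Prod>i<k. real_of_int (z - int i)) else 0)"

definition sym_factor :: "nat list \<Rightarrow> nat" where
  "sym_factor a = (\<Prod>v\<in>set a. fact (count_list a v))"

definition kappa :: "nat list \<Rightarrow> real" where
  "kappa a = fact (ell a) / ((\<Prod>v\<leftarrow>a. fact v) * real (sym_factor a))"

definition ffun :: "nat \<Rightarrow> nat \<Rightarrow> nat \<Rightarrow> real" where
  "ffun r l k = (\<Prod>i\<in>{1..<r}. (real k - real i)) / real k ^ (l - 1)"

definition m_rl :: "nat \<Rightarrow> nat \<Rightarrow> nat" where
  "m_rl r l = (THE k. r \<le> k \<and> (\<forall>j\<ge>r. ffun r l j \<le> ffun r l k))"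

definition Pbar :: "(nat \<Rightarrow> real) set" where
  "Pbar = {x. (\<forall>i. x (Suc i) \<le> x i) \<and> (\<forall>i. 0 \<le> x i) \<and> summable x \<and> suminf x \<le> 1}"

definition xzero :: "(nat \<Rightarrow> real) \<Rightarrow> real" where
  "xzero x = 1 - suminf x"

definition Ssum :: "nat list \<Rightarrow> (nat \<Rightarrow> real) \<Rightarrow> real" where
  "Ssum ds x = infsum (\<lambda>is. \<Prod>j<length ds. x (is ! j) ^ (ds ! j))
                      {is. length is = length ds \<and> distinct is}"

definition pF :: "nat list \<Rightarrow> (nat \<Rightarrow> real) \<Rightarrow> real" where
  "pF a x = kappa a * (\<Sum>i\<le>sc a. real (sc a choose i) * xzero x ^ i
                                  * Ssum (take (length a - i) a) x)"

definition simp_k :: "nat \<Rightarrow> (nat \<Rightarrow> real) set" where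
  "simp_k k = {x \<in> Pbar. (\<forall>i\<ge>k. x i = 0) \<and> (\<Sum>i<k. x i) = 1}"

definition kvec :: "nat \<Rightarrow> nat \<Rightarrow> real" where
  "kvec k = (\<lambda>i. if i < k then 1 / real k else 0)"

definition OPT_on :: "nat list \<Rightarrow> (nat \<Rightarrow> real) set \<Rightarrow> (nat \<Rightarrow> real) set" where
  "OPT_on a S = {x \<in> S. \<forall>y\<in>S. pF a y \<le> pF a x}"

definition OPT_k :: "nat list \<Rightarrow> nat \<Rightarrow> (nat \<Rightarrow> real) set" where
  "OPT_k a k = OPT_on a (simp_k k)"

definition OPT :: "nat list \<Rightarrow> (nat \<Rightarrow> real) set" where
  "OPT a = OPT_on a Pbar"

definition is_max_value :: "nat list \<Rightarrow> (nat \<Rightarrow> real) set \<Rightarrow> real \<Rightarrow> bool" where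
  "is_max_value a S v \<longleftrightarrow> (\<forall>y\<in>S. pF a y \<le> v) \<and> (\<exists>y\<in>S. pF a y = v)"

end

theory Submission
  imports Defs
begin

text \<open>
  Fix the sum \<open>y + z\<close> of two coordinates and put \<open>t = ((y - z) / (y + z))\<^sup>2\<close>. Since
  \<open>(a\<^sub>1 - a\<^sub>r choose 2) < a\<^sub>r\<close>, as a function of \<open>t\<close> the polynomial lies below its chord between
  \<open>t = 0\<close> (equal coordinates) and \<open>t = 1\<close> (merged coordinates). Hence, if \<open>M\<close> is the maximum,
  merging two unequal coordinates multiplies the deficit \<open>M - p\<close> by at most \<open>1 / t\<close>. Merging all
  coordinates leads to a single vertex, where \<open>p = 0\<close>; so the initial deficit is bounded below by a
  positive multiple of \<open>M\<close> unless all nonzero coordinates are equal. The factors \<open>1 / t\<close> for many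
  small coordinates have a bounded product, so the bound survives the limit that replaces \<open>x\<^sub>0\<close> and an
  infinite tail by many small coordinates. Therefore all maximisers are uniform, the value at
  \<open>\<^bold>k\<close> is \<open>\<kappa>\<^sub>F f(k)\<close>, and the result follows from the unimodality of \<open>f\<close>.
\<close>

section \<open>Chord inequalities for two coordinates\<close>

text \<open>The deficit is tracked multiplicatively because a mere strict inequality could be lost
  in the limit: the approximating lists get ever longer, so the bound must depend on the mass and
  not on the number of merges. Absorbing an entry e into y with e + g \<le> y costs the factor 1 / t
  = ((y + e) / (y - e))^2, at most exp (4 e / g), and the absorbed masses add up to at most 1; this
  is the origin of exp (- 4 / g). The obstacle is a pair of equal entries: there t = 0 and the chord
  says nothing. So merging starts at a largest entry s, first absorbs everything different from s,
  and only then the other copies of s, which by now lie below the accumulated entry. This order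
  needs some positive mass away from s, that is, a point that is not uniform. The condition on F is
  forced by the terms with two parts on the two vertices: a merged vertex hosts only one part, so
  their chord vanishes at t = 1. Compactness makes the argument available on finite simplices first;
  the bound f(m) found there for lists of every length then plays the role of M for the infinite
  case.\<close>

lemma sum_power_le_chord:
  fixes h :: real
  assumes "0 \<le> h" "h \<le> 1"
  shows "(1 + h) ^ Suc n + (1 - h) ^ Suc n \<le> 2 + h\<^sup>2 * (2 ^ Suc n - 2)
       \<and> (1 + h) ^ Suc n - (1 - h) ^ Suc n \<le> h * 2 ^ Suc n"
\<comment> \<open>The two bounds need each other: with P and N the two powers, the next sum is (P +
  N) + h (P - N) and the next difference is (P - N) + h (P + N).\<close>
proof (induction n)
  case 0
  then show ?case by simp
next
  case (Suc n)
  define P where "P = (1 + h) ^ Suc n"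
  define N where "N = (1 - h) ^ Suc n"
  define T :: real where "T = 2 ^ Suc n"
  have T: "2 \<le> T" unfolding T_def by simp
  have IH: "P + N \<le> 2 + h\<^sup>2 * (T - 2)" "P - N \<le> h * T"
    using Suc unfolding P_def N_def T_def by auto
  have hD: "h * (P - N) \<le> h * (h * T)"
    using IH(2) assms(1) by (rule mult_left_mono)
  have "h\<^sup>2 * (T - 2) \<le> 1 * (T - 2)"
    using assms T by (intro mult_right_mono) (auto simp: power_le_one)
  then have "P + N \<le> T" using IH(1) by simp
  then have hA: "h * (P + N) \<le> h * T"
    using assms(1) by (rule mult_left_mono)
  have e: "(1 + h) ^ Suc (Suc n) = P + h * P" "(1 - h) ^ Suc (Suc n) = N - h * N"
    "2 ^ Suc (Suc n) = 2 * T"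
    unfolding P_def N_def T_def by (simp_all add: algebra_simps)
  show ?case
    unfolding e using IH hD hA by (simp add: algebra_simps power2_eq_square)
qed

text \<open>For h = tanh x this is tanh (d x) \<le> d tanh x. It limits the growth of the sum of the
  two powers: when the exponent rises from d to d + 1, the sum grows by a factor of at most 1 + d
  h^2.\<close>

lemma diff_power_le_sum_power:
  fixes h :: real
  assumes "0 \<le> h" "h \<le> 1"
  shows "(1 + h) ^ d - (1 - h) ^ d \<le> real d * h * ((1 + h) ^ d + (1 - h) ^ d)"
proof (induction d)
  case (Suc d)
  define P where "P = (1 + h) ^ d"
  define N where "N = (1 - h) ^ d"
  have NP: "N \<le> P" unfolding P_def N_def using assms by (intro power_mono) auto
  have "real (Suc d) * h * (P + N) \<le> real (Suc d) * h * (P + N + h * (P - N))"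
    using assms NP by (intro mult_left_mono) auto
  moreover have "P - N + h * (P + N) \<le> real (Suc d) * h * (P + N)"
    using Suc unfolding P_def N_def by (simp add: algebra_simps)
  ultimately have "P - N + h * (P + N) \<le> real (Suc d) * h * (P + N + h * (P - N))"
    by linarith
  moreover have "(1 + h) ^ Suc d - (1 - h) ^ Suc d = P - N + h * (P + N)"
    "(1 + h) ^ Suc d + (1 - h) ^ Suc d = P + N + h * (P - N)"
    unfolding P_def N_def by (simp_all add: algebra_simps)
  ultimately show ?case by (simp only:)
qed simp

text \<open>The exponent \<open>d choose 2\<close> is where the almost balanced condition comes from.\<close>

lemma balanced_power_le:
  fixes h :: real
  assumes "0 \<le> h" "h \<le> 1"
  shows "(1 - h\<^sup>2) ^ (d choose 2) * ((1 + h) ^ d + (1 - h) ^ d) \<le> 2"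
proof (induction d)
  case (Suc d)
  define P where "P = (1 + h) ^ d"
  define N where "N = (1 - h) ^ d"
  define t where "t = h\<^sup>2"
  have t: "0 \<le> t" "t \<le> 1" unfolding t_def using assms by (auto simp: power_le_one)
  have PN: "0 \<le> P + N" unfolding P_def N_def using assms by simp
  have D: "h * (P - N) \<le> real d * t * (P + N)"
    using mult_left_mono[OF diff_power_le_sum_power[OF assms, of d] assms(1)]
    unfolding P_def N_def t_def by (simp add: power2_eq_square mult_ac)
  \<comment> \<open>Since \<open>Suc d choose 2\<close> exceeds \<open>d choose 2\<close> by d,
    there are d new factors 1 - t to absorb the growth factor 1 + d t. They suffice because 1 + d t
    \<le> (1 + t)^d.\<close>
  have "(1 - t) ^ d * (1 + real d * t) \<le> (1 - t) ^ d * (1 + t) ^ d"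
    using t Bernoulli_inequality[of t d] by (intro mult_left_mono) auto
  also have "\<dots> = (1 - t\<^sup>2) ^ d"
    by (simp add: power_mult_distrib[symmetric] algebra_simps power2_eq_square)
  also have "\<dots> \<le> 1"
    using t by (intro power_le_one) (auto simp: power_le_one)
  finally have B: "(1 - t) ^ d * (1 + real d * t) \<le> 1" .
  have "(1 - t) ^ d * (P + N + h * (P - N)) \<le> (1 - t) ^ d * ((1 + real d * t) * (P + N))"
    using D t by (intro mult_left_mono) (auto simp: algebra_simps)
  also have "\<dots> \<le> P + N"
    using mult_right_mono[OF B PN] by (simp add: mult_ac)
  finally have S: "(1 - t) ^ d * (P + N + h * (P - N)) \<le> P + N" .
  have c: "Suc d choose 2 = (d choose 2) + d"
    by (simp add: numeral_2_eq_2)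
  have "(1 - t) ^ (Suc d choose 2) * ((1 + h) ^ Suc d + (1 - h) ^ Suc d)
      = (1 - t) ^ (d choose 2) * ((1 - t) ^ d * (P + N + h * (P - N)))"
    unfolding c P_def N_def by (simp add: power_add algebra_simps)
  also have "\<dots> \<le> (1 - t) ^ (d choose 2) * (P + N)"
    using S t by (intro mult_left_mono) auto
  also have "\<dots> \<le> 2"
    using Suc unfolding t_def P_def N_def by simp
  finally show ?case unfolding t_def .
qed (simp add: numeral_2_eq_2)

lemma split_ratio:
  fixes y z :: real
  assumes "0 \<le> z" "z \<le> y" "0 < y"
  obtains h where "0 \<le> h" "h \<le> 1" "h = (y - z) / (y + z)"
    "y = (y + z) / 2 * (1 + h)" "z = (y + z) / 2 * (1 - h)"
proof -
  have "0 \<le> (y - z) / (y + z)" "(y - z) / (y + z) \<le> 1"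
    "y = (y + z) / 2 * (1 + (y - z) / (y + z))" "z = (y + z) / 2 * (1 - (y - z) / (y + z))"
    using assms by (auto simp: field_simps)
  then show ?thesis using that by blast
qed

text \<open>This treats one part on one of the two vertices. For fixed y + z the odd powers of h
  cancel, so the left side is a polynomial in t = h^2 with nonnegative coefficients, hence convex
  and below its chord. Positivity of d matters: for d = 0 the left side is 2 and the chord is 2 -
  t.\<close>

lemma power_sum_chord:
  fixes y z :: real
  assumes "0 \<le> z" "z \<le> y" "0 < y" "1 \<le> d"
  shows "y ^ d + z ^ d \<le> ((y - z) / (y + z))\<^sup>2 * (y + z) ^ d
           + (1 - ((y - z) / (y + z))\<^sup>2) * (2 * ((y + z) / 2) ^ d)"
proof -
  obtain h where h: "0 \<le> h" "h \<le> 1" "h = (y - z) / (y + z)"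
    "y = (y + z) / 2 * (1 + h)" "z = (y + z) / 2 * (1 - h)"
    using split_ratio[OF assms(1-3)] by blast
  define q where "q = (y + z) / 2"
  have q: "0 \<le> q" and w: "y + z = 2 * q" unfolding q_def using assms by auto
  obtain n where n: "d = Suc n" using assms(4) by (cases d) auto
  have "y ^ d + z ^ d = q ^ d * ((1 + h) ^ d + (1 - h) ^ d)"
    using h(4,5) unfolding q_def[symmetric] by (metis distrib_left power_mult_distrib)
  also have "\<dots> \<le> q ^ d * (2 + h\<^sup>2 * (2 ^ d - 2))"
    unfolding n using sum_power_le_chord[OF h(1,2), of n] q by (intro mult_left_mono) auto
  also have "\<dots> = h\<^sup>2 * (2 * q) ^ d + (1 - h\<^sup>2) * (2 * q ^ d)"
    by (simp add: algebra_simps power_mult_distrib)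
  finally show ?thesis unfolding h(3)[symmetric] q_def[symmetric] w[symmetric] .
qed

text \<open>This treats two parts on the two vertices. The common power of y z supplies q factors 1
  - t, which must pay both for the remaining sum of powers and for the zero of the chord at t =
  1.\<close>

lemma power_prod_chord_aux:
  fixes y z :: real
  assumes "0 \<le> z" "z \<le> y" "0 < y" "q \<le> p" "(p - q) choose 2 < q"
  shows "y ^ p * z ^ q + z ^ p * y ^ q
       \<le> (1 - ((y - z) / (y + z))\<^sup>2) * (2 * ((y + z) / 2) ^ (p + q))"
proof -
  obtain h where h: "0 \<le> h" "h \<le> 1" "h = (y - z) / (y + z)"
    "y = (y + z) / 2 * (1 + h)" "z = (y + z) / 2 * (1 - h)"
    using split_ratio[OF assms(1-3)] by blast
  define v where "v = (y + z) / 2"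
  have v: "0 \<le> v" unfolding v_def using assms by auto
  define d where "d = p - q"
  \<comment> \<open>One factor 1 - t is kept for the chord, \<open>d choose 2\<close> factors go
    into \<open>balanced_power_le\<close>, and the e spare ones are bounded by 1.\<close>
  obtain e where e: "q = Suc ((d choose 2) + e)"
    using assms(5) unfolding d_def[symmetric] by (metis add_Suc_right less_natE)
  have p: "p = q + d" using assms(4) unfolding d_def by simp
  define t where "t = h\<^sup>2"
  have t: "0 \<le> t" "t \<le> 1" unfolding t_def using h by (auto simp: power_le_one)
  have yz: "y * z = v\<^sup>2 * (1 - t)"
  proof -
    have "y * z = (v * (1 + h)) * (v * (1 - h))"
      using h(4,5) unfolding v_def[symmetric] by simp
    then show ?thesis unfolding t_def by (simp add: algebra_simps power2_eq_square)
  qed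
  have yd: "y ^ d + z ^ d = v ^ d * ((1 + h) ^ d + (1 - h) ^ d)"
    using h(4,5) unfolding v_def[symmetric] by (metis distrib_left power_mult_distrib)
  define A where "A = (1 + h) ^ d + (1 - h) ^ d"
  have A: "(1 - t) ^ (d choose 2) * A \<le> 2"
    using balanced_power_le[OF h(1,2)] unfolding t_def A_def .
  have A0: "0 \<le> A" unfolding A_def using h by simp
  have "(1 - t) ^ e * ((1 - t) ^ (d choose 2) * A) \<le> 1 * ((1 - t) ^ (d choose 2) * A)"
    using t A0 by (intro mult_right_mono) (auto simp: power_le_one)
  then have *: "(1 - t) ^ e * ((1 - t) ^ (d choose 2) * A) \<le> 2" using A by simp
  have "y ^ p * z ^ q + z ^ p * y ^ q = (y * z) ^ q * (y ^ d + z ^ d)"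
    unfolding p by (simp add: power_add power_mult_distrib algebra_simps)
  also have "\<dots> = v ^ (2 * q) * (1 - t) ^ q * (v ^ d * A)"
    unfolding yz yd A_def[symmetric] by (simp add: power_mult_distrib power_mult)
  also have "\<dots> = v ^ (p + q) * (1 - t) ^ q * A"
    unfolding p mult_2 power_add by (simp only: mult_ac)
  also have "(1 - t) ^ q = (1 - t) * ((1 - t) ^ e * (1 - t) ^ (d choose 2))"
    unfolding e by (simp add: power_add)
  also have "v ^ (p + q) * ((1 - t) * ((1 - t) ^ e * (1 - t) ^ (d choose 2))) * A
      = v ^ (p + q) * (1 - t) * ((1 - t) ^ e * ((1 - t) ^ (d choose 2) * A))"
    by (simp only: mult_ac)
  also have "\<dots> \<le> v ^ (p + q) * (1 - t) * 2"
    using * t v by (intro mult_left_mono) auto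
  finally show ?thesis unfolding h(3)[symmetric] v_def[symmetric] t_def[symmetric]
    by (simp add: mult_ac)
qed

text \<open>By symmetry the larger exponent may be taken first. Subtraction is truncated, so for q
  \<le> p the last hypothesis only says 0 < p.\<close>

lemma power_prod_chord:
  fixes y z :: real
  assumes "0 \<le> z" "z \<le> y" "0 < y" "(p - q) choose 2 < q" "(q - p) choose 2 < p"
  shows "y ^ p * z ^ q + z ^ p * y ^ q
       \<le> (1 - ((y - z) / (y + z))\<^sup>2) * (2 * ((y + z) / 2) ^ (p + q))"
proof (cases "q \<le> p")
  case True
  then show ?thesis using power_prod_chord_aux assms by blast
next
  case False
  then have "p \<le> q" by simp
  from power_prod_chord_aux[OF assms(1-3) this assms(5)] show ?thesis
    by (simp add: add.commute mult.commute)
qed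

text \<open>\<open>psum d J xs\<close> is the finite form of \<open>S\<close>: the parts \<open>j \<in> J\<close>, of size \<open>d j\<close>, are
  placed on distinct entries of \<open>xs\<close>.\<close>

fun psum :: "(nat \<Rightarrow> nat) \<Rightarrow> nat set \<Rightarrow> real list \<Rightarrow> real" where
  "psum d J [] = (if J = {} then 1 else 0)"
| "psum d J (y # ys) = psum d J ys + (\<Sum>a\<in>J. y ^ d a * psum d (J - {a}) ys)"

section \<open>Finite sums: sign, zero entries and independence of the order of the entries\<close>

lemma psum_nonneg: "(\<And>x. x \<in> set xs \<Longrightarrow> 0 \<le> x) \<Longrightarrow> 0 \<le> psum d J xs"
  by (induction xs arbitrary: J) (auto intro!: add_nonneg_nonneg sum_nonneg mult_nonneg_nonneg)

lemma psum_zero [simp]: "(\<And>a. a \<in> J \<Longrightarrow> 1 \<le> d a) \<Longrightarrow> psum d J (0 # ys) = psum d J ys"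
  by (force intro!: sum.neutral simp: power_0_left)

lemma psum_singleton: "finite J \<Longrightarrow> 2 \<le> card J \<Longrightarrow> psum d J [x] = 0"
proof -
  assume J: "finite J" "2 \<le> card J"
  have "J \<noteq> {}" using J by auto
  moreover have "J - {a} \<noteq> {}" if "a \<in> J" for a
    using J card_Diff_singleton[OF that] by force
  ultimately show ?thesis by (auto intro!: sum.neutral)
qed

lemma psum_Cons2:
  "psum d J (y # z # ys) = psum d J ys
    + (\<Sum>a\<in>J. (y ^ d a + z ^ d a) * psum d (J - {a}) ys)
    + (\<Sum>a\<in>J. \<Sum>b\<in>J - {a}. y ^ d a * z ^ d b * psum d (J - {a} - {b}) ys)"
  by (simp add: sum.distrib algebra_simps sum_distrib_left)

lemma psum_pairs_commute:
  assumes "finite J"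
  shows "(\<Sum>a\<in>J. \<Sum>b\<in>J - {a}. y ^ d a * z ^ d b * psum d (J - {a} - {b}) ys)
       = (\<Sum>a\<in>J. \<Sum>b\<in>J - {a}. z ^ d a * y ^ d b * psum d (J - {a} - {b}) ys)"
proof -
  have "(\<Sum>a\<in>J. \<Sum>b\<in>J - {a}. y ^ d a * z ^ d b * psum d (J - {a} - {b}) ys)
      = (\<Sum>a\<in>J. \<Sum>b | b \<in> J \<and> a \<noteq> b. y ^ d a * z ^ d b * psum d (J - {a} - {b}) ys)"
    by (intro sum.cong) auto
  also have "\<dots> = (\<Sum>b\<in>J. \<Sum>a | a \<in> J \<and> a \<noteq> b. y ^ d a * z ^ d b * psum d (J - {a} - {b}) ys)"
    by (rule sum.swap_restrict[OF assms assms])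
  also have "\<dots> = (\<Sum>b\<in>J. \<Sum>a\<in>J - {b}. z ^ d b * y ^ d a * psum d (J - {b} - {a}) ys)"
  proof (intro sum.cong refl)
    fix b a assume "b \<in> J" "a \<in> J - {b}"
    have "J - {a} - {b} = J - {b} - {a}" by auto
    then show "y ^ d a * z ^ d b * psum d (J - {a} - {b}) ys = z ^ d b * y ^ d a * psum d (J - {b} - {a}) ys"
      by simp
  qed auto
  finally show ?thesis .
qed

lemma psum_swap: "finite J \<Longrightarrow> psum d J (y # z # ys) = psum d J (z # y # ys)"
  using psum_pairs_commute[of J y d z ys] unfolding psum_Cons2 by (simp add: add.commute)

lemma psum_middle: "finite J \<Longrightarrow> psum d J (xs @ y # zs) = psum d J (y # xs @ zs)"
proof (induction xs arbitrary: J)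
  case (Cons x xs)
  have "psum d J ((x # xs) @ y # zs) = psum d J (x # y # xs @ zs)"
    using Cons by simp
  also have "\<dots> = psum d J (y # x # xs @ zs)" by (rule psum_swap[OF Cons.prems])
  finally show ?case by simp
qed simp

lemma psum_mset: "finite J \<Longrightarrow> mset xs = mset ys \<Longrightarrow> psum d J xs = psum d J ys"
proof (induction xs arbitrary: J ys)
  case (Cons x xs)
  have "x \<in> set ys" using Cons.prems(2) by (metis list.set_intros(1) set_mset_mset)
  then obtain us vs where ys: "ys = us @ x # vs" by (meson split_list)
  have "mset xs = mset (us @ vs)" using Cons.prems(2) unfolding ys by simp
  then have "psum d K xs = psum d K (us @ vs)" if "finite K" for K using Cons.IH that by blast
  then have "psum d J (x # xs) = psum d J (x # us @ vs)"
    using Cons.prems(1) by simp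
  then show ?case unfolding ys psum_middle[OF Cons.prems(1)] .
qed simp

text \<open>The terms are sorted by how many parts sit on the two vertices: none gives a constant,
  one gives \<open>power_sum_chord\<close>, two give \<open>power_prod_chord\<close>.\<close>

lemma psum_chord:
  fixes y z :: real
  assumes fin: "finite J" and bal: "\<And>p q. p \<in> J \<Longrightarrow> q \<in> J \<Longrightarrow> (d p - d q) choose 2 < d q"
    and yz: "0 \<le> z" "z \<le> y" "0 < y" and ys: "\<And>x. x \<in> set ys \<Longrightarrow> 0 \<le> x"
  defines "t \<equiv> ((y - z) / (y + z))\<^sup>2"
  shows "psum d J (y # z # ys) \<le> t * psum d J ((y + z) # ys)
           + (1 - t) * psum d J ((y + z) / 2 # (y + z) / 2 # ys)"
proof -
  define w where "w = y + z"
  \<comment> \<open>For p = q the balance condition reads 0 < d p, so it also says that parts are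
    nonempty.\<close>
  have d1: "1 \<le> d a" if "a \<in> J" for a using bal[OF that that] by simp
  define S1 where "S1 f = (\<Sum>a\<in>J. f (d a) * psum d (J - {a}) ys)" for f :: "nat \<Rightarrow> real"
  define S2 where "S2 f = (\<Sum>a\<in>J. \<Sum>b\<in>J - {a}. f (d a) (d b) * psum d (J - {a} - {b}) ys)"
    for f :: "nat \<Rightarrow> nat \<Rightarrow> real"
  have p0: "0 \<le> psum d K ys" for K using ys by (rule psum_nonneg)
  \<comment> \<open>The chord bound for two parts holds only after symmetrising in the two vertices,
    so each ordered pair of parts is averaged over both placements; hence the division by 2.\<close>
  have e: "psum d J (u # v # ys) = psum d J ys + S1 (\<lambda>a. u ^ a + v ^ a)
      + S2 (\<lambda>a b. u ^ a * v ^ b + v ^ a * u ^ b) / 2" for u v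
    using psum_pairs_commute[OF fin, of u d v ys] unfolding S1_def S2_def psum_Cons2
    by (simp add: distrib_right sum.distrib)
  have m: "psum d J (w # ys) = psum d J ys + S1 (\<lambda>a. w ^ a)"
    unfolding S1_def by simp
  have "S1 (\<lambda>a. y ^ a + z ^ a) \<le> (\<Sum>a\<in>J. (t * w ^ d a + (1 - t) * (2 * (w / 2) ^ d a)) * psum d (J - {a}) ys)"
    unfolding S1_def t_def w_def
    using d1 by (intro sum_mono mult_right_mono p0 power_sum_chord yz) auto
  also have "\<dots> = t * S1 (\<lambda>a. w ^ a) + (1 - t) * S1 (\<lambda>a. (w / 2) ^ a + (w / 2) ^ a)"
    unfolding S1_def by (simp add: sum_distrib_left sum.distrib[symmetric] algebra_simps)
  finally have 1: "S1 (\<lambda>a. y ^ a + z ^ a)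
    \<le> t * S1 (\<lambda>a. w ^ a) + (1 - t) * S1 (\<lambda>a. (w / 2) ^ a + (w / 2) ^ a)" .
  have "S2 (\<lambda>a b. y ^ a * z ^ b + z ^ a * y ^ b)
     \<le> (\<Sum>a\<in>J. \<Sum>b\<in>J - {a}. ((1 - t) * (2 * (w / 2) ^ (d a + d b))) * psum d (J - {a} - {b}) ys)"
    unfolding S2_def t_def w_def
    using bal by (intro sum_mono mult_right_mono p0 power_prod_chord yz) auto
  also have "\<dots> = (1 - t) * S2 (\<lambda>a b. (w / 2) ^ a * (w / 2) ^ b + (w / 2) ^ a * (w / 2) ^ b)"
    unfolding S2_def sum_distrib_left by (intro sum.cong refl) (simp add: power_add mult_ac)
  finally have 2: "S2 (\<lambda>a b. y ^ a * z ^ b + z ^ a * y ^ b)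
    \<le> (1 - t) * S2 (\<lambda>a b. (w / 2) ^ a * (w / 2) ^ b + (w / 2) ^ a * (w / 2) ^ b)" .
  show ?thesis
    unfolding w_def[symmetric] e m using 1 2 by (simp only: algebra_simps)
qed

definition prob_list :: "real list \<Rightarrow> bool" where
  "prob_list xs \<longleftrightarrow> (\<forall>x\<in>set xs. 0 \<le> x) \<and> sum_list xs = 1"

section \<open>Merging coordinates\<close>

text \<open>The equalised pair in the chord keeps the length of the list, so M is required as a
  bound up to length k only. The accumulated entry can only grow, so the distance g to the entries
  still to come persists, and the exponents add up to the absorbed mass.\<close>

lemma psum_merge:
  assumes fin: "finite J" and bal: "\<And>p q. p \<in> J \<Longrightarrow> q \<in> J \<Longrightarrow> (d p - d q) choose 2 < d q"
    and M: "\<And>xs. prob_list xs \<Longrightarrow> length xs \<le> k \<Longrightarrow> psum d J xs \<le> M" and g: "0 < g"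
    and es: "\<And>e. e \<in> set es \<Longrightarrow> e + g \<le> y"
    and "prob_list (y # es @ rest)" "length (y # es @ rest) \<le> k"
  shows "M - psum d J ((y + sum_list es) # rest)
       \<le> exp (4 * sum_list es / g) * (M - psum d J (y # es @ rest))"
  using es assms(6,7)
proof (induction es arbitrary: y)
  case (Cons e es)
  have nn: "0 \<le> e" "e + g \<le> y" "\<And>x. x \<in> set (es @ rest) \<Longrightarrow> 0 \<le> x"
    using Cons.prems unfolding prob_list_def by auto
  have pl: "prob_list ((y + e) # es @ rest)" "prob_list ((y + e) / 2 # (y + e) / 2 # es @ rest)"
    using Cons.prems(2) nn g unfolding prob_list_def by auto
  define t where "t = ((y - e) / (y + e))\<^sup>2"
  have t: "0 < t" unfolding t_def using nn g by auto
  have t1: "t \<le> 1"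
    unfolding t_def using nn g by (intro power_le_one) (auto simp: divide_le_eq)
  define P where "P = psum d J (y # e # es @ rest)"
  define P1 where "P1 = psum d J ((y + e) # es @ rest)"
  define P2 where "P2 = psum d J ((y + e) / 2 # (y + e) / 2 # es @ rest)"
  have "P2 \<le> M" unfolding P2_def using M[OF pl(2)] Cons.prems(3) by simp
  have "P \<le> M" unfolding P_def by (rule M) (use Cons.prems(2,3) in auto)
  have "P \<le> t * P1 + (1 - t) * P2"
    unfolding P_def P1_def P2_def t_def
    by (rule psum_chord[OF fin bal]) (use nn g in auto)
  also have "\<dots> \<le> t * P1 + (1 - t) * M"
    using \<open>P2 \<le> M\<close> t1 by (intro add_left_mono mult_left_mono) auto
  finally have "t * (M - P1) \<le> M - P" by (simp add: algebra_simps)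
  then have 1: "M - P1 \<le> (M - P) / t" using t by (simp add: field_simps)
  have "(y + e) / (y - e) = 1 + 2 * e / (y - e)" using nn g by (simp add: field_simps)
  also have "\<dots> \<le> 1 + 2 * e / g"
    using nn g by (intro add_left_mono divide_left_mono) auto
  also have "\<dots> \<le> exp (2 * e / g)" by (rule exp_ge_add_one_self)
  finally have "((y + e) / (y - e))\<^sup>2 \<le> (exp (2 * e / g))\<^sup>2"
    using nn g by (intro power_mono) auto
  also have "\<dots> = exp (4 * e / g)" by (simp add: exp_double[symmetric])
  finally have "1 / t \<le> exp (4 * e / g)" unfolding t_def by (simp add: power_divide)
  then have "(M - P) / t \<le> exp (4 * e / g) * (M - P)"
    using mult_right_mono[of "1 / t" _ "M - P"] \<open>P \<le> M\<close> by simp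
  with 1 have 2: "M - P1 \<le> exp (4 * e / g) * (M - P)" by linarith
  have "M - psum d J ((y + e + sum_list es) # rest) \<le> exp (4 * sum_list es / g) * (M - P1)"
    unfolding P1_def using Cons.prems nn g pl
    by (intro Cons.IH) (auto simp: add_increasing2)
  also have "\<dots> \<le> exp (4 * sum_list es / g) * (exp (4 * e / g) * (M - P))"
    using 2 by (intro mult_left_mono) auto
  also have "\<dots> = exp (4 * sum_list (e # es) / g) * (M - P)"
    by (simp add: exp_add[symmetric] add_divide_distrib algebra_simps)
  finally show ?case unfolding P_def by (simp add: add.assoc)
qed simp

text \<open>The last condition serves the second round of merging: once a mass of at least g
  different from s has been absorbed, the remaining copies of s are at least g below the accumulated
  entry.\<close>

definition gap_list :: "real \<Rightarrow> real \<Rightarrow> real list \<Rightarrow> bool" where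
  "gap_list g s xs \<longleftrightarrow> prob_list xs \<and> s \<in> set xs \<and> (\<forall>e\<in>set xs. e = s \<or> e + g \<le> s) \<and>
     g \<le> sum_list (filter (\<lambda>e. e \<noteq> s) xs)"

lemma psum_gap:
  assumes fin: "finite J" and J: "2 \<le> card J"
    and bal: "\<And>p q. p \<in> J \<Longrightarrow> q \<in> J \<Longrightarrow> (d p - d q) choose 2 < d q"
    and M: "\<And>xs. prob_list xs \<Longrightarrow> length xs \<le> k \<Longrightarrow> psum d J xs \<le> M" and g: "0 < g"
    and gl: "gap_list g s xs" and len: "length xs \<le> k"
  shows "psum d J xs \<le> M * (1 - exp (- 4 / g))"
proof -
  have xs: "prob_list xs" "length xs \<le> k" and s: "s \<in> set xs"
    and gap: "\<And>e. e \<in> set xs \<Longrightarrow> e = s \<or> e + g \<le> s"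
    and rest: "g \<le> sum_list (filter (\<lambda>e. e \<noteq> s) xs)"
    using gl len unfolding gap_list_def by auto
  define A where "A = filter (\<lambda>e. e \<noteq> s) xs"
  define B where "B = remove1 s (filter (\<lambda>e. e = s) xs)"
  have mx: "mset xs = mset (s # A @ B)"
  proof -
    have "mset xs = mset (filter (\<lambda>e. e = s) xs) + mset A"
      unfolding A_def by simp
    moreover have "mset (filter (\<lambda>e. e = s) xs) = mset (s # B)"
      unfolding B_def using s by simp
    ultimately show ?thesis by simp
  qed
  have sx: "set xs = set (s # A @ B)" using mx by (metis set_mset_mset)
  have sm: "sum_list xs = s + sum_list A + sum_list B"
    by (metis mx sum_mset_sum_list sum_list.Cons sum_list.append add.assoc)
  have lx: "length xs = length (s # A @ B)" using mx by (metis size_mset)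
  have pl: "prob_list (s # A @ B)" using xs(1) sx sm unfolding prob_list_def by simp
  have B: "b = s" if "b \<in> set B" for b
    using that notin_set_remove1 unfolding B_def by fastforce
  have nn: "0 \<le> sum_list A" "0 \<le> sum_list B" "0 \<le> s"
    using pl unfolding prob_list_def by (auto intro!: sum_list_nonneg)
  have 1: "M - psum d J ((s + sum_list A) # B)
       \<le> exp (4 * sum_list A / g) * (M - psum d J (s # A @ B))"
  proof (rule psum_merge[OF fin bal M g])
    fix e assume "e \<in> set A"
    then show "e + g \<le> s" using gap[of e] unfolding A_def by auto
  qed (use pl lx xs in auto)
  have pl2: "prob_list ((s + sum_list A) # B @ [])"
    using pl nn unfolding prob_list_def by auto
  have 2: "M - psum d J ((s + sum_list A + sum_list B) # [])
       \<le> exp (4 * sum_list B / g) * (M - psum d J ((s + sum_list A) # B @ []))"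
  proof (rule psum_merge[OF fin bal M g])
    fix e assume "e \<in> set B"
    then show "e + g \<le> s + sum_list A" using B rest unfolding A_def by auto
  qed (use pl2 lx xs in auto)
  have le: "psum d J (s # A @ B) \<le> M" using M[OF pl] lx xs by simp
  \<comment> \<open>Two parts do not fit on a single vertex, so the deficit left at the end is M
    itself.\<close>
  have "M \<le> exp (4 * sum_list B / g) * (M - psum d J ((s + sum_list A) # B))"
    using 2 psum_singleton[OF fin J] by simp
  also have "\<dots> \<le> exp (4 * sum_list B / g) * (exp (4 * sum_list A / g) * (M - psum d J (s # A @ B)))"
    using 1 by (intro mult_left_mono) auto
  also have "\<dots> = exp (4 * (sum_list A + sum_list B) / g) * (M - psum d J (s # A @ B))"
    by (simp add: exp_add[symmetric] add_divide_distrib algebra_simps)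
  also have "\<dots> \<le> exp (4 / g) * (M - psum d J (s # A @ B))"
    using le g sm xs(1) nn unfolding prob_list_def
    by (intro mult_right_mono) (auto simp: divide_right_mono)
  finally have "M * exp (- 4 / g) \<le> M - psum d J (s # A @ B)"
    by (simp add: exp_minus field_simps)
  then show ?thesis using psum_mset[OF fin mx] by (simp add: algebra_simps)
qed

lemma psum_replicate:
  assumes "finite J"
  shows "psum d J (replicate n c) = (\<Prod>i<card J. real n - real i) * c ^ (\<Sum>a\<in>J. d a)"
  using assms
proof (induction n arbitrary: J)
  case 0
  show ?case
  proof (cases "J = {}")
    case False
    then have "0 < card J" using 0 by (simp add: card_gt_0_iff)
    then have "(\<Prod>i<card J. real 0 - real i) = 0" by (intro prod_zero) auto
    then show ?thesis using False by simp
  qed simp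
next
  case (Suc n)
  define D where "D = (\<Sum>a\<in>J. d a)"
  have "c ^ d a * psum d (J - {a}) (replicate n c) = (\<Prod>i<card J - 1. real n - real i) * c ^ D"
    if "a \<in> J" for a
  proof -
    have "D = d a + (\<Sum>b\<in>J - {a}. d b)" unfolding D_def using that Suc.prems by (rule sum.remove[rotated])
    then show ?thesis using Suc that by (simp add: card_Diff_singleton power_add)
  qed
  then have "(\<Sum>a\<in>J. c ^ d a * psum d (J - {a}) (replicate n c))
      = (\<Sum>a\<in>J. (\<Prod>i<card J - 1. real n - real i) * c ^ D)"
    by (intro sum.cong) auto
  then have "psum d J (replicate (Suc n) c) = (\<Prod>i<card J. real n - real i) * c ^ D
      + real (card J) * (\<Prod>i<card J - 1. real n - real i) * c ^ D"
    using Suc unfolding D_def by simp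
  moreover have "(\<Prod>i<card J. real n - real i) + real (card J) * (\<Prod>i<card J - 1. real n - real i)
      = (\<Prod>i<card J. real (Suc n) - real i)"
  proof (cases "card J")
    case (Suc q)
    have "(\<Prod>i<Suc q. real (Suc n) - real i) = real (Suc n) * (\<Prod>i<q. real n - real i)"
      by (subst prod.lessThan_Suc_shift) simp
    then show ?thesis using Suc by (simp add: algebra_simps)
  qed simp
  ultimately show ?case unfolding D_def by (metis distrib_right)
qed

lemma sum_list_map_upt: "sum_list (map x [0..<n]) = (\<Sum>i<n. x i)"
  for x :: "nat \<Rightarrow> real"
  by (simp add: interv_sum_list_conv_sum_set_nat lessThan_atLeast0)

section \<open>The maximum over finite simplices\<close>

lemma continuous_on_psum: "continuous_on UNIV (\<lambda>x::nat \<Rightarrow> real. psum d J (map x is))"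
  by (induction "is" arbitrary: J) (auto intro!: continuous_intros)

lemma psum_append_zeros:
  "(\<And>a. a \<in> J \<Longrightarrow> 1 \<le> d a) \<Longrightarrow> finite J \<Longrightarrow> psum d J (xs @ replicate n 0) = psum d J xs"
proof (induction n)
  case (Suc n)
  have "psum d J (xs @ 0 # replicate n 0) = psum d J (0 # xs @ replicate n 0)"
    by (rule psum_middle) (rule Suc.prems)
  also have "\<dots> = psum d J (xs @ replicate n 0)" using Suc.prems(1) by (rule psum_zero)
  finally show ?case using Suc by simp
qed simp

lemma psum_filter_nonzero:
  "(\<And>a. a \<in> J \<Longrightarrow> 1 \<le> d a) \<Longrightarrow> psum d J (filter (\<lambda>x. x \<noteq> 0) xs) = psum d J xs"
proof (induction xs arbitrary: J)
  case (Cons x xs)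
  have IH: "psum d K (filter (\<lambda>x. x \<noteq> 0) xs) = psum d K xs" if "K \<subseteq> J" for K
    using Cons that by blast
  show ?case
  proof (cases "x = 0")
    case True
    then show ?thesis using IH[of J] psum_zero[OF Cons.prems] by simp
  next
    case False
    then show ?thesis using IH by (auto intro!: sum.cong arg_cong2[where f = "(+)"])
  qed
qed simp

text \<open>Lists are padded with zeros to functions on the naturals whose coordinates from k on are
  pinned to 0. This set is a closed slice of a product of compact sets, so compactness in the
  product topology applies.\<close>

lemma psum_max_exists:
  assumes fin: "finite J" and d: "\<And>a. a \<in> J \<Longrightarrow> 1 \<le> d a" and k: "1 \<le> k"
  obtains xs where "prob_list xs" "length xs \<le> k"
    "\<And>ys. prob_list ys \<Longrightarrow> length ys \<le> k \<Longrightarrow> psum d J ys \<le> psum d J xs"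
proof -
  define B where "B = (\<lambda>i::nat. if i < k then {0..1::real} else {0})"
  define S where "S = Pi\<^sub>E UNIV B \<inter> {x. (\<Sum>i<k. x i) = 1}"
  have "compactin (product_topology (\<lambda>i. euclidean) UNIV) (Pi\<^sub>E UNIV B)"
    unfolding compactin_PiE B_def by simp
  then have "compact (Pi\<^sub>E UNIV B)"
    by (simp add: euclidean_product_topology)
  moreover have "closed {x::nat \<Rightarrow> real. (\<Sum>i<k. x i) = 1}"
    by (intro closed_Collect_eq continuous_intros continuous_on_product_coordinates)
  ultimately have "compact S" unfolding S_def by (rule compact_Int_closed)
  moreover have "(\<lambda>i. if i = 0 then 1 else 0) \<in> S"
    using k unfolding S_def B_def by (auto simp: PiE_iff)
  then have "S \<noteq> {}" by blast
  moreover have "continuous_on S (\<lambda>x. psum d J (map x [0..<k]))"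
    using continuous_on_psum continuous_on_subset by blast
  ultimately obtain x where x: "x \<in> S"
    "\<And>y. y \<in> S \<Longrightarrow> psum d J (map y [0..<k]) \<le> psum d J (map x [0..<k])"
    using continuous_attains_sup by metis
  show ?thesis
  proof (rule that)
    have "(\<Sum>i<k. x i) = 1" using x(1) unfolding S_def by simp
    moreover have "x i \<in> B i" for i using x(1) unfolding S_def by (auto simp: PiE_iff)
    ultimately show "prob_list (map x [0..<k])"
      unfolding prob_list_def B_def by (force simp: sum_list_map_upt split: if_splits)
  next
    fix ys assume ys: "prob_list ys" "length ys \<le> k"
    define zs where "zs = ys @ replicate (k - length ys) 0"
    define y where "y i = (if i < k then zs ! i else 0)" for i
    have zy: "map y [0..<k] = zs"
      using ys(2) unfolding y_def zs_def by (intro nth_equalityI) auto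
    have zs: "prob_list zs" using ys unfolding zs_def prob_list_def by (auto simp: sum_list_replicate)
    have len: "length zs = k" using ys(2) unfolding zs_def by simp
    have "zs ! i \<in> {0..1}" if "i < k" for i
    proof -
      have "zs ! i \<in> set zs" using that len by simp
      moreover have "e \<in> {0..1}" if e: "e \<in> set zs" for e
      proof -
        obtain us vs where split: "zs = us @ e # vs" using e by (meson split_list)
        have "0 \<le> sum_list us" "0 \<le> sum_list vs"
          using zs unfolding prob_list_def split by (auto intro!: sum_list_nonneg)
        then show ?thesis using zs unfolding prob_list_def split by auto
      qed
      ultimately show ?thesis by blast
    qed
    moreover have "(\<Sum>i<k. y i) = 1"
      using zs zy sum_list_map_upt[of y k] unfolding prob_list_def by simp
    ultimately have "y \<in> S" unfolding S_def B_def y_def by (auto simp: PiE_iff)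
    then have "psum d J zs \<le> psum d J (map x [0..<k])" using x(2) zy by metis
    then show "psum d J ys \<le> psum d J (map x [0..<k])"
      unfolding zs_def using psum_append_zeros[OF d fin] by simp
  qed simp
qed

lemma psum_uniform_value:
  assumes "card J = r" "1 \<le> r" "(\<Sum>a\<in>J. d a) = l" "1 \<le> l" "1 \<le> j"
  shows "psum d J (replicate j (1 / real j)) = ffun r l j"
proof -
  have "finite J" using assms by (intro card_ge_0_finite) simp
  moreover obtain p where p: "r = Suc p" using assms(2) by (cases r) auto
  moreover obtain q where q: "l = Suc q" using assms(4) by (cases l) auto
  \<comment> \<open>The factor with i = 0 cancels one of the l powers of j; hence the exponent l - 1
    in \<open>ffun\<close>.\<close>
  have "(\<Prod>i<r. real j - real i) = real j * (\<Prod>i\<in>{1..<r}. real j - real i)"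
    unfolding p by (simp add: prod.atLeast_Suc_lessThan lessThan_atLeast0)
  ultimately show ?thesis
    using assms unfolding ffun_def q by (simp add: psum_replicate power_divide)
qed

lemma psum_uniform:
  assumes d: "\<And>a. a \<in> J \<Longrightarrow> 1 \<le> d a"
    and J: "card J = r" "1 \<le> r" "(\<Sum>a\<in>J. d a) = l" "1 \<le> l"
    and xs: "prob_list xs" "\<And>x. x \<in> set xs \<Longrightarrow> x = 0 \<or> x = s"
  obtains j where "1 \<le> j" "j \<le> length xs" "psum d J xs = ffun r l j"
proof -
  define ys where "ys = filter (\<lambda>x. x \<noteq> 0) xs"
  define j where "j = length ys"
  have ys: "ys = replicate j s"
    unfolding j_def by (rule replicate_length_same[symmetric]) (use xs(2) ys_def in auto)
  have "sum_list ys = sum_list xs" unfolding ys_def by (induction xs) auto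
  then have js: "real j * s = 1" using xs(1) unfolding prob_list_def ys by (simp add: sum_list_replicate)
  then have j: "1 \<le> j" by (cases j) auto
  have "s = 1 / real j" using js j by (simp add: field_simps)
  then have "psum d J xs = psum d J (replicate j (1 / real j))"
    using psum_filter_nonzero[of J d xs] d ys unfolding ys_def by simp
  then have "psum d J xs = ffun r l j" using psum_uniform_value J j by metis
  moreover have "j \<le> length xs" unfolding j_def ys_def by simp
  ultimately show ?thesis using that j by blast
qed

text \<open>The gap estimate is applied to a maximiser, with M its own value. If this value is
  positive and some nonzero entry differs from the largest one, the value would be at most itself
  times a factor below 1. So a maximiser with positive value is uniform up to zeros.\<close>

lemma psum_le:
  assumes J: "card J = r" "2 \<le> r" "(\<Sum>a\<in>J. d a) = l"
    and bal: "\<And>p q. p \<in> J \<Longrightarrow> q \<in> J \<Longrightarrow> (d p - d q) choose 2 < d q"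
    and B: "\<And>j. 1 \<le> j \<Longrightarrow> j \<le> k \<Longrightarrow> ffun r l j \<le> B"
    and ys: "prob_list ys" "length ys \<le> k"
  shows "psum d J ys \<le> B"
proof -
  have fin: "finite J" using J by (intro card_ge_0_finite) simp
  have d: "1 \<le> d a" if "a \<in> J" for a using bal[OF that that] by simp
  obtain a where "a \<in> J" using J by fastforce
  then have l: "1 \<le> l" using member_le_sum[of a J d] fin d[of a] J(3) by simp
  have k: "1 \<le> k" using ys unfolding prob_list_def by (cases ys) auto
  obtain xs where xs: "prob_list xs" "length xs \<le> k"
    "\<And>ys. prob_list ys \<Longrightarrow> length ys \<le> k \<Longrightarrow> psum d J ys \<le> psum d J xs"
    by (rule psum_max_exists[where J = J and d = d and k = k, OF fin d k]) (assumption, rule that)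
  have "psum d J xs \<le> B"
  proof (cases "psum d J xs \<le> 0")
    case True
    \<comment> \<open>The uniform point with one entry has value 0, so the hypothesis on B at j = 1
      gives 0 \<le> B.\<close>
    have "(\<Prod>i\<in>{1..<r}. real 1 - real i) = 0" using J(2) by (intro prod_zero) auto
    then have "ffun r l 1 = 0" unfolding ffun_def by simp
    then show ?thesis using B[of 1] k True by simp
  next
    case False
    define s where "s = Max (set xs)"
    define A where "A = filter (\<lambda>e. e \<noteq> s) xs"
    have ne: "xs \<noteq> []" using xs(1) unfolding prob_list_def by auto
    have s: "s \<in> set xs" unfolding s_def using ne by simp
    have le: "e \<le> s" if "e \<in> set xs" for e unfolding s_def using that by simp
    have A0: "0 \<le> e" if "e \<in> set A" for e
      using xs(1) that unfolding A_def prob_list_def by auto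
    have "sum_list A = 0"
    proof (rule ccontr)
      assume ne0: "sum_list A \<noteq> 0"
      then have pos: "0 < sum_list A" using A0 sum_list_nonneg[of A] by fastforce
      have Ane: "set A \<noteq> {}" using ne0 by auto
      \<comment> \<open>The two bounds are the mass away from s and the distance from s to the
        second largest value.\<close>
      define g where "g = min (sum_list A) (s - Max (set A))"
      have "Max (set A) \<in> set A" using Ane by simp
      then have "Max (set A) < s" using le unfolding A_def by force
      then have g: "0 < g" unfolding g_def using pos by simp
      have "e = s \<or> e + g \<le> s" if "e \<in> set xs" for e
      proof -
        have "e = s \<or> e \<in> set A" using that unfolding A_def by simp
        moreover have "e \<le> Max (set A)" if "e \<in> set A" using that by simp
        ultimately show ?thesis unfolding g_def by linarith
      qed
      moreover have "g \<le> sum_list A" unfolding g_def by simp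
      ultimately have "gap_list g s xs" unfolding gap_list_def A_def using xs(1) s by simp
      then have "psum d J xs \<le> psum d J xs * (1 - exp (- 4 / g))"
        using psum_gap[OF fin _ bal xs(3) g _ xs(2)] J by simp
      then show False using False by (simp add: algebra_simps) (smt (verit) exp_gt_zero mult_pos_pos)
    qed
    then have "\<forall>e\<in>set A. e = 0" using A0 sum_list_nonneg_eq_0_iff by blast
    then have "x = 0 \<or> x = s" if "x \<in> set xs" for x using that unfolding A_def by auto
    then obtain j where "1 \<le> j" "j \<le> length xs" "psum d J xs = ffun r l j"
      using psum_uniform[OF d J(1) _ J(3) l xs(1)] J(2) by (metis One_nat_def Suc_leD numeral_2_eq_2)
    then show ?thesis using B[of j] xs(2) by simp
  qed
  then show ?thesis using xs(3)[OF ys] by linarith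
qed

section \<open>Unimodality of \<open>f\<close>\<close>

text \<open>The quotient f(j) / f(j + 1) written in u = 1 / j. For j \<ge> r a value above 1 means
  that f descends from j to j + 1.\<close>

definition psi :: "nat \<Rightarrow> nat \<Rightarrow> real \<Rightarrow> real" where
  "psi r l u = (1 - (real r - 1) * u) * (1 + u) ^ (l - 1)"

lemma ffun_pos: "r \<le> k \<Longrightarrow> 1 \<le> k \<Longrightarrow> 0 < ffun r l k"
  unfolding ffun_def by (auto intro!: divide_pos_pos prod_pos)

lemma ffun_step:
  assumes "2 \<le> r" "r < l" "r \<le> j"
  shows "ffun r l j = psi r l (1 / real j) * ffun r l (Suc j)"
proof -
  obtain p where p: "r = Suc p" using assms(1) by (cases r) auto
  have "(\<Prod>i\<in>{1..<r}. real (Suc j) - real i) = (\<Prod>i<p. real j - real i)"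
    unfolding p by (rule prod.reindex_bij_witness[where i = Suc and j = "\<lambda>i. i - 1"]) auto
  moreover have "(real j - (real r - 1)) * (\<Prod>i<p. real j - real i) = (\<Prod>i<r. real j - real i)"
    unfolding p by simp
  moreover have "(\<Prod>i<r. real j - real i) = real j * (\<Prod>i\<in>{1..<r}. real j - real i)"
    unfolding p by (simp add: prod.atLeast_Suc_lessThan lessThan_atLeast0)
  ultimately have *: "(real j - (real r - 1)) * (\<Prod>i\<in>{1..<r}. real (Suc j) - real i)
      = real j * (\<Prod>i\<in>{1..<r}. real j - real i)" by simp
  have j: "0 < real j" using assms by simp
  have quot: "(A / x * (w / x) ^ n) * (P / w ^ n) = A * P / x / x ^ n"
    if "0 < w" "0 < x" for w x A P :: real and n
    using that by (simp add: power_divide)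
  have "1 - (real r - 1) * (1 / real j) = (real j - (real r - 1)) / real j"
    "1 + 1 / real j = real (Suc j) / real j"
    using j by (simp_all add: field_simps)
  then have "psi r l (1 / real j) * ffun r l (Suc j)
     = ((real j - (real r - 1)) * (\<Prod>i\<in>{1..<r}. real (Suc j) - real i)) / real j / real j ^ (l - 1)"
    unfolding psi_def ffun_def using quot[of "real (Suc j)" "real j"] j by simp
  also have "\<dots> = ffun r l j" unfolding * ffun_def using j by simp
  finally show ?thesis by simp
qed

text \<open>Equality would say (j + 1 - r) (j + 1)^(l - 1) = j^l, but j + 1 is coprime to j. This
  excludes ties between neighbouring values of f and makes the maximiser unique.\<close>

lemma psi_neq_1:
  assumes "2 \<le> r" "r < l" "r \<le> j"
  shows "psi r l (1 / real j) \<noteq> 1"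
proof
  assume eq: "psi r l (1 / real j) = 1"
  have j: "0 < real j" using assms by simp
  have l: "real j ^ l = real j * real j ^ (l - 1)" using assms by (simp flip: power_Suc)
  have clear: "A * w ^ n = x * x ^ n" if "(A / x) * (w ^ n / x ^ n) = 1" "0 < x" for A w x :: real and n
    using that by simp
  have e: "1 - (real r - 1) * (1 / real j) = real (j + 1 - r) / real j"
    "1 + 1 / real j = real (j + 1) / real j"
    using j assms by (simp_all add: field_simps of_nat_diff)
  have "real (j + 1 - r) / real j * (real (j + 1) ^ (l - 1) / real j ^ (l - 1)) = 1"
    using eq unfolding psi_def e power_divide .
  then have "real (j + 1 - r) * real (j + 1) ^ (l - 1) = real j ^ l"
    unfolding l using j by (rule clear)
  then have "real ((j + 1 - r) * (j + 1) ^ (l - 1)) = real (j ^ l)" by simp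
  then have "(j + 1 - r) * (j + 1) ^ (l - 1) = j ^ l" by (simp only: of_nat_eq_iff)
  moreover have "j + 1 dvd (j + 1) ^ (l - 1)" using assms by (intro dvd_power) auto
  ultimately have "j + 1 dvd j ^ l" by (metis dvd_mult)
  moreover have "coprime (j + 1) (j ^ l)" by simp
  ultimately have "j + 1 = 1" by (metis coprime_common_divisor_nat dvd_refl)
  then show False using assms by simp
qed

text \<open>In the variable \<open>u = 1 / k\<close> the quotient of consecutive values of \<open>f\<close> is a
  log-concave function with value 1 at 0, so it passes the value 1 at most once.\<close>

lemma psi_ge_1_mono:
  assumes r: "2 \<le> r" and u: "0 < u" "(real r - 1) * u < 1" "1 \<le> psi r l u" and v: "0 < v" "v \<le> u"
  shows "1 \<le> psi r l v"
proof -
  define c where "c = v / u"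
  have c: "0 < c" "c \<le> 1" "v = c * u" unfolding c_def using u v by auto
  \<comment> \<open>Both bases in \<open>psi\<close> are affine in u with value 1 at 0, so passing
    from u to v = c u is a convex combination with 1.\<close>
  have conc: "c * ln x \<le> ln ((1 - c) * 1 + c * x)" if "0 < x" for x :: real
  proof -
    have "(1 - c) * ln 1 + c * ln x \<le> ln ((1 - c) * 1 + c * x)"
      using concave_onD[OF ln_concave, of c 1 x] c that by simp
    then show ?thesis by simp
  qed
  have pos: "0 < 1 - (real r - 1) * u" "0 < 1 + u" "0 < 1 + v" using u v by auto
  have "(real r - 1) * v \<le> (real r - 1) * u" using v r by (intro mult_left_mono) auto
  then have pos2: "0 < 1 - (real r - 1) * v" using u by simp
  have l1: "ln (psi r l u) = ln (1 - (real r - 1) * u) + real (l - 1) * ln (1 + u)"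
    unfolding psi_def using pos by (simp add: ln_mult_pos ln_realpow)
  have l2: "ln (psi r l v) = ln (1 - (real r - 1) * v) + real (l - 1) * ln (1 + v)"
    unfolding psi_def using pos pos2 by (simp add: ln_mult_pos ln_realpow)
  have "0 \<le> c * ln (psi r l u)" using c u by simp
  also have "\<dots> = c * ln (1 - (real r - 1) * u) + real (l - 1) * (c * ln (1 + u))"
    unfolding l1 by (simp add: algebra_simps)
  also have "\<dots> \<le> ln (1 - (real r - 1) * v) + real (l - 1) * ln (1 + v)"
  proof (intro add_mono mult_left_mono)
    show "c * ln (1 - (real r - 1) * u) \<le> ln (1 - (real r - 1) * v)"
      using conc[OF pos(1)] unfolding c(3) by (simp add: algebra_simps)
    show "c * ln (1 + u) \<le> ln (1 + v)"
      using conc[OF pos(2)] unfolding c(3) by (simp add: algebra_simps)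
  qed simp
  also have "\<dots> = ln (psi r l v)" using l2 by simp
  finally show ?thesis
    using pos pos2 unfolding psi_def by (subst (asm) ln_ge_zero_iff) auto
qed

text \<open>By Bernoulli the quotient is at least 1 + u ((l - r) - (r - 1) (l - 1) u). Since l - r
  \<ge> 1, the crude threshold j \<ge> r l makes the bracket positive. So f eventually
  descends.\<close>

lemma psi_gt_1:
  assumes "2 \<le> r" "r < l" "r * l \<le> j"
  shows "1 < psi r l (1 / real j)"
proof -
  define u where "u = 1 / real j"
  have "0 < r * l" using assms by simp
  then have j: "0 < real j" using assms(3) by linarith
  have rj: "r \<le> j" using assms by (metis le_trans less_imp_le_nat less_nat_zero_code mult_le_mono2 nat_mult_1_right not_less_eq_eq One_nat_def not_less)
  have u: "0 < u" "(real r - 1) * u < 1" unfolding u_def using j rj by (auto simp: field_simps)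
  have "(real r - 1) * (real l - 1) < real r * real l"
    using assms by (simp add: algebra_simps)
  also have "\<dots> \<le> real j" using assms(3) by (metis of_nat_le_iff of_nat_mult)
  also have "\<dots> \<le> (real l - real r) * real j"
    using assms j by (simp add: mult_le_cancel_right1)
  finally have "(real r - 1) * (real l - 1) * u < real l - real r"
    unfolding u_def using j by (simp add: field_simps)
  then have "0 < u * ((real l - real r) - (real r - 1) * (real l - 1) * u)" using u by simp
  then have "1 < (1 - (real r - 1) * u) * (1 + real (l - 1) * u)"
    using assms by (simp add: algebra_simps of_nat_diff)
  also have "\<dots> \<le> (1 - (real r - 1) * u) * (1 + u) ^ (l - 1)"
    using u Bernoulli_inequality[of u "l - 1"] by (intro mult_left_mono) auto
  finally show ?thesis unfolding psi_def u_def .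
qed

text \<open>The comparisons start at j = 1 because uniform points with fewer than r entries compete
  as well; there one factor j - i is zero and f vanishes.\<close>

lemma ffun_unimodal:
  assumes r: "2 \<le> r" "r < l"
  shows "r \<le> m_rl r l"
    and "\<And>j. 1 \<le> j \<Longrightarrow> j \<noteq> m_rl r l \<Longrightarrow> ffun r l j < ffun r l (m_rl r l)"
    and "\<And>j k. 1 \<le> j \<Longrightarrow> j < k \<Longrightarrow> r \<le> k \<Longrightarrow> k \<le> m_rl r l \<Longrightarrow> ffun r l j < ffun r l k"
proof -
  \<comment> \<open>The first descent of f. Earlier quotients are not above 1 and never equal to 1,
    so f rises strictly; later ones stay at least 1 by \<open>psi_ge_1_mono\<close>, so f falls
    strictly.\<close>
  define m where "m = (LEAST j. r \<le> j \<and> 1 < psi r l (1 / real j))"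
  have ex: "r \<le> m \<and> 1 < psi r l (1 / real m)"
    unfolding m_def
  proof (rule LeastI)
    show "r \<le> r * l \<and> 1 < psi r l (1 / real (r * l))" using psi_gt_1[OF r order_refl] r by simp
  qed
  have up: "ffun r l j < ffun r l (Suc j)" if "r \<le> j" "j < m" for j
  proof -
    have "psi r l (1 / real j) < 1"
      using not_less_Least[of j "\<lambda>j. r \<le> j \<and> 1 < psi r l (1 / real j)"] psi_neq_1[OF r that(1)] that
      unfolding m_def by auto
    then show ?thesis
      unfolding ffun_step[OF r that(1)] using ffun_pos[of r "Suc j" l] that by simp
  qed
  have down: "ffun r l (Suc j) < ffun r l j" if "m \<le> j" for j
  proof -
    have rj: "r \<le> j" "r \<le> m" using that ex by auto
    have "1 \<le> psi r l (1 / real j)"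
      using psi_ge_1_mono[OF r(1), of "1 / real m" l "1 / real j"] ex that rj r
      by (auto simp: field_simps)
    then have "1 < psi r l (1 / real j)" using psi_neq_1[OF r rj(1)] by simp
    then show ?thesis
      unfolding ffun_step[OF r rj(1)] using ffun_pos[of r "Suc j" l] rj by simp
  qed
  have zero: "ffun r l j = 0" if "1 \<le> j" "j < r" for j
  proof -
    have "(\<Prod>i\<in>{1..<r}. real j - real i) = 0" using that by (intro prod_zero) auto
    then show ?thesis unfolding ffun_def by simp
  qed
  have mono: "ffun r l j < ffun r l k" if "1 \<le> j" "j < k" "r \<le> k" "k \<le> m" for j k
  proof (cases "r \<le> j")
    case True
    have "k \<le> m \<Longrightarrow> ffun r l j < ffun r l k"
      using that(2)
    proof (induction k)
      case (Suc k)
      then show ?case using up[of k] True by (cases "j = k") auto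
    qed simp
    then show ?thesis using that by blast
  next
    case False
    then show ?thesis using zero[OF that(1)] ffun_pos[of r k l] that by simp
  qed
  have anti: "ffun r l k < ffun r l m" if "m < k" for k
    using that
  proof (induction k)
    case (Suc k)
    then show ?case using down[of k] by (cases "m = k") auto
  qed simp
  have max: "ffun r l j < ffun r l m" if "1 \<le> j" "j \<noteq> m" for j
    using mono[of j m] anti[of j] that ex by (cases "j < m") auto
  have "m_rl r l = m"
    unfolding m_rl_def
  proof (rule the_equality)
    show "r \<le> m \<and> (\<forall>j\<ge>r. ffun r l j \<le> ffun r l m)"
      using ex max r by (metis le_trans less_imp_le one_le_numeral order_refl)
  next
    fix k assume k: "r \<le> k \<and> (\<forall>j\<ge>r. ffun r l j \<le> ffun r l k)"
    then have "ffun r l m \<le> ffun r l k" using ex by blast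
    then show "k = m" using max[of k] k r by fastforce
  qed
  then show "r \<le> m_rl r l"
    "\<And>j. 1 \<le> j \<Longrightarrow> j \<noteq> m_rl r l \<Longrightarrow> ffun r l j < ffun r l (m_rl r l)"
    "\<And>j k. 1 \<le> j \<Longrightarrow> j < k \<Longrightarrow> r \<le> k \<Longrightarrow> k \<le> m_rl r l \<Longrightarrow> ffun r l j < ffun r l k"
    using ex max mono by auto
qed

section \<open>The polynomial \<open>p\<^sub>F\<close> as a limit of finite sums\<close>

text \<open>This turns the recursion into a sum over placements of the parts, the form in which
  \<open>Ssum\<close> is defined.\<close>

lemma psum_injections:
  assumes "finite J" "distinct is"
  shows "psum d J (map x is)
       = (\<Sum>\<phi> | \<phi> \<in> J \<rightarrow>\<^sub>E set is \<and> inj_on \<phi> J. \<Prod>j\<in>J. x (\<phi> j) ^ d j)"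
  using assms
proof (induction "is" arbitrary: J)
  case Nil
  show ?case
  proof (cases "J = {}")
    case True
    then have "{\<phi>. \<phi> \<in> J \<rightarrow>\<^sub>E set [] \<and> inj_on \<phi> J} = {\<lambda>_. undefined}" by auto
    then show ?thesis using True by simp
  next
    case False
    then have "J \<rightarrow>\<^sub>E ({}::'a set) = {}" by (auto simp: PiE_eq_empty_iff)
    then show ?thesis using False by simp
  qed
next
  case (Cons i "is")
  define Inj where "Inj K I = {\<phi>. \<phi> \<in> K \<rightarrow>\<^sub>E I \<and> inj_on \<phi> K}" for K :: "nat set" and I :: "'a set"
  define w where "w K \<phi> = (\<Prod>j\<in>K. x (\<phi> j) ^ d j)" for K \<phi>
  define I where "I = set is"
  have iI: "i \<notin> I" unfolding I_def using Cons.prems by simp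
  have finI: "finite (Inj K I')" if "finite K" "finite I'" for K I'
    unfolding Inj_def by (rule finite_subset[OF _ finite_PiE[of K "\<lambda>_. I'"]]) (use that in auto)
  have IH: "psum d K (map x is) = sum (w K) (Inj K I)" if "finite K" for K
    using Cons.IH[OF that] Cons.prems unfolding Inj_def w_def I_def by simp
  have split: "Inj J (insert i I) = Inj J I \<union> {\<phi> \<in> Inj J (insert i I). i \<in> \<phi> ` J}"
    unfolding Inj_def by (auto simp: PiE_iff)
  have "sum (w J) (Inj J (insert i I))
      = sum (w J) (Inj J I) + sum (w J) {\<phi> \<in> Inj J (insert i I). i \<in> \<phi> ` J}"
  proof (subst split, rule sum.union_disjoint)
    show "Inj J I \<inter> {\<phi> \<in> Inj J (insert i I). i \<in> \<phi> ` J} = {}"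
      unfolding Inj_def using iI by (auto simp: PiE_iff)
  qed (use finI Cons.prems in \<open>auto simp: I_def\<close>)
  \<comment> \<open>An injection that hits i is determined by the part a sent to i and its
    restriction to the other parts.\<close>
  also have "sum (w J) {\<phi> \<in> Inj J (insert i I). i \<in> \<phi> ` J}
     = (\<Sum>(a, \<phi>) \<in> Sigma J (\<lambda>a. Inj (J - {a}) I). x i ^ d a * w (J - {a}) \<phi>)"
  proof (rule sum.reindex_bij_witness[symmetric, where
        i = "\<lambda>\<phi>. (inv_into J \<phi> i, restrict \<phi> (J - {inv_into J \<phi> i}))" and
        j = "\<lambda>(a, \<phi>). \<phi>(a := i)"], goal_cases)
    case (1 p)
    obtain a \<phi> where p: "p = (a, \<phi>)" "a \<in> J" "\<phi> \<in> Inj (J - {a}) I" using 1 by auto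
    have inj: "inj_on (\<phi>(a := i)) J"
      using p(2,3) iI unfolding Inj_def by (auto simp: inj_on_def PiE_iff)
    have "inv_into J (\<phi>(a := i)) i = a"
      using inv_into_f_f[OF inj p(2)] by simp
    moreover have "restrict (\<phi>(a := i)) (J - {a}) = \<phi>"
      using p(3) unfolding Inj_def by (auto simp: PiE_iff extensional_def restrict_def fun_eq_iff)
    ultimately show ?case using p(1) by simp
  next
    case (2 p)
    then obtain a \<phi> where p: "p = (a, \<phi>)" "a \<in> J" "\<phi> \<in> Inj (J - {a}) I" by auto
    have "inj_on (\<phi>(a := i)) J"
      using p(2,3) iI unfolding Inj_def by (auto simp: inj_on_def PiE_iff)
    moreover have "\<phi>(a := i) \<in> J \<rightarrow>\<^sub>E insert i I"
      using p(2,3) unfolding Inj_def by (auto simp: PiE_iff extensional_def)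
    moreover have "i \<in> (\<phi>(a := i)) ` J"
      using p(2) by (rule rev_image_eqI) simp
    ultimately show ?case unfolding Inj_def p(1) by simp
  next
    case (3 \<phi>)
    define a where "a = inv_into J \<phi> i"
    have a: "a \<in> J" "\<phi> a = i"
      using 3 unfolding a_def by (auto intro: inv_into_into f_inv_into_f)
    show ?case using 3 a unfolding a_def[symmetric] Inj_def
      by (auto simp: PiE_iff extensional_def restrict_def fun_eq_iff)
  next
    case (4 \<phi>)
    define a where "a = inv_into J \<phi> i"
    have a: "a \<in> J" "\<phi> a = i"
      using 4 unfolding a_def by (auto intro: inv_into_into f_inv_into_f)
    have "\<phi> b \<in> I" if "b \<in> J" "b \<noteq> a" for b
      using 4 a that unfolding Inj_def inj_on_def PiE_iff by blast
    then show ?case using 4 a unfolding a_def[symmetric] Inj_def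
      by (auto simp: PiE_iff inj_on_def)
  next
    case (5 p)
    obtain a \<phi> where p: "p = (a, \<phi>)" "a \<in> J" "\<phi> \<in> Inj (J - {a}) I" using 5 by auto
    have "w J (\<phi>(a := i)) = x i ^ d a * w (J - {a}) \<phi>"
      unfolding w_def using Cons.prems(1) p(2) by (subst prod.remove[of _ a]) auto
    then show ?case using p(1) by simp
  qed
  also have "\<dots> = (\<Sum>a\<in>J. \<Sum>\<phi>\<in>Inj (J - {a}) I. x i ^ d a * w (J - {a}) \<phi>)"
    using finI Cons.prems(1) by (intro sum.Sigma[symmetric]) (auto simp: I_def)
  also have "\<dots> = (\<Sum>a\<in>J. x i ^ d a * psum d (J - {a}) (map x is))"
    using IH Cons.prems(1) by (simp add: sum_distrib_left)
  finally show ?case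
    using IH[OF Cons.prems(1)] unfolding Inj_def w_def I_def by simp
qed

lemma psum_lists:
  "(\<Sum>is | length is = length ds \<and> distinct is \<and> set is \<subseteq> {..<n}. \<Prod>j<length ds. x (is ! j) ^ (ds ! j))
   = psum ((!) ds) {..<length ds} (map x [0..<n])"
proof -
  have "(\<Sum>is | length is = length ds \<and> distinct is \<and> set is \<subseteq> {..<n}. \<Prod>j<length ds. x (is ! j) ^ (ds ! j))
   = (\<Sum>\<phi> | \<phi> \<in> {..<length ds} \<rightarrow>\<^sub>E {..<n} \<and> inj_on \<phi> {..<length ds}. \<Prod>j<length ds. x (\<phi> j) ^ (ds ! j))"
  proof (rule sum.reindex_bij_witness[where
        i = "\<lambda>\<phi>. map \<phi> [0..<length ds]" and j = "\<lambda>is. restrict ((!) is) {..<length ds}"], goal_cases)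
    case (1 "is")
    then show ?case by (auto intro: nth_equalityI)
  next
    case (2 "is")
    then have "is ! j < n" if "j < length ds" for j
      using nth_mem[of j "is"] that by (simp add: subset_iff)
    then show ?case using 2 by (auto simp: inj_on_def nth_eq_iff_index_eq)
  next
    case (3 \<phi>)
    then show ?case by (auto simp: PiE_iff extensional_def fun_eq_iff restrict_def)
  next
    case (4 \<phi>)
    then show ?case by (auto simp: distinct_map PiE_iff lessThan_atLeast0)
  next
    case (5 "is")
    then show ?case by (intro prod.cong) auto
  qed
  then show ?thesis by (simp add: psum_injections lessThan_atLeast0)
qed

lemma psum_le_exp:
  assumes "finite J" "\<And>a. a \<in> J \<Longrightarrow> 1 \<le> d a" "\<And>x. x \<in> set xs \<Longrightarrow> 0 \<le> x \<and> x \<le> 1"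
  shows "psum d J xs \<le> exp (real (card J) * sum_list xs)"
  using assms
proof (induction xs arbitrary: J)
  case (Cons y ys)
  define S where "S = sum_list ys"
  have S: "0 \<le> S" unfolding S_def using Cons.prems by (intro sum_list_nonneg) auto
  have y: "0 \<le> y" "y \<le> 1" using Cons.prems by auto
  have "y ^ d a * psum d (J - {a}) ys \<le> y * exp (real (card J) * S)" if "a \<in> J" for a
  proof (intro mult_mono)
    show "y ^ d a \<le> y" using power_decreasing[of 1 "d a" y] y Cons.prems(2)[OF that] by simp
    have "psum d (J - {a}) ys \<le> exp (real (card (J - {a})) * S)"
      unfolding S_def using Cons.prems by (intro Cons.IH) auto
    also have "\<dots> \<le> exp (real (card J) * S)"
      using S Cons.prems(1) by (auto intro!: mult_right_mono simp: card_mono)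
    finally show "psum d (J - {a}) ys \<le> exp (real (card J) * S)" .
  qed (use y Cons.prems in \<open>auto intro!: psum_nonneg\<close>)
  then have "(\<Sum>a\<in>J. y ^ d a * psum d (J - {a}) ys) \<le> real (card J) * (y * exp (real (card J) * S))"
    by (rule sum_bounded_above)
  moreover have "psum d J ys \<le> exp (real (card J) * S)"
    unfolding S_def using Cons.prems by (intro Cons.IH) auto
  ultimately have "psum d J (y # ys) \<le> (1 + real (card J) * y) * exp (real (card J) * S)"
    by (simp add: algebra_simps)
  also have "\<dots> \<le> exp (real (card J) * y) * exp (real (card J) * S)"
    by (intro mult_right_mono exp_ge_add_one_self) auto
  also have "\<dots> = exp (real (card J) * sum_list (y # ys))"
    unfolding S_def by (simp add: exp_add[symmetric] algebra_simps)
  finally show ?case .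
qed simp

text \<open>\<open>infsum\<close> defaults to 0 on families that are not summable, so summability
  must come first: the terms are nonnegative and their finite sums are bounded through
  \<open>psum_le_exp\<close>.\<close>

lemma Ssum_tendsto:
  assumes x: "\<And>i. 0 \<le> x i" "\<And>n. (\<Sum>i<n. x i) \<le> 1" and ds: "\<And>v. v \<in> set ds \<Longrightarrow> 1 \<le> v"
  shows "(\<lambda>n. psum ((!) ds) {..<length ds} (map x [0..<n])) \<longlonglongrightarrow> Ssum ds x"
proof -
  define f where "f is = (\<Prod>j<length ds. x (is ! j) ^ (ds ! j))" for "is"
  define A where "A = {is::nat list. length is = length ds \<and> distinct is}"
  define L where "L n = {is::nat list. length is = length ds \<and> distinct is \<and> set is \<subseteq> {..<n}}" for n
  have LA: "L n \<subseteq> A" for n unfolding L_def A_def by auto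
  have finL: "finite (L n)" for n
    by (rule finite_subset[OF _ finite_lists_length_eq[of "{..<n}" "length ds"]]) (auto simp: L_def)
  have L_sum: "sum f (L n) = psum ((!) ds) {..<length ds} (map x [0..<n])" for n
    unfolding L_def f_def by (rule psum_lists)
  have x1: "x i \<le> 1" for i
    using member_le_sum[of i "{..<Suc i}" x] x by (meson finite_lessThan lessI lessThan_iff order_trans DiffD1)
  have f0: "0 \<le> f is" for "is" unfolding f_def using x(1) by (intro prod_nonneg) auto
  have cover: "\<exists>n. \<forall>m\<ge>n. F \<subseteq> L m" if "finite F" "F \<subseteq> A" for F
  proof -
    have "finite (\<Union> (set ` F))" using that by auto
    then obtain n where "\<forall>i\<in>\<Union> (set ` F). i < n" using finite_nat_set_iff_bounded by auto
    then have "\<forall>m\<ge>n. F \<subseteq> L m" using that(2) unfolding L_def A_def by fastforce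
    then show ?thesis by blast
  qed
  have bound: "sum f F \<le> exp (real (length ds))" if F: "finite F" "F \<subseteq> A" for F
  proof -
    obtain n where n: "F \<subseteq> L n" using cover[OF F] by blast
    have "sum f F \<le> sum f (L n)" using n f0 finL by (intro sum_mono2) auto
    also have "\<dots> \<le> exp (real (card {..<length ds}) * sum_list (map x [0..<n]))"
      unfolding L_sum using x(1) x1 ds by (intro psum_le_exp) auto
    also have "\<dots> \<le> exp (real (length ds))"
      using x(2)[of n] by (simp add: sum_list_map_upt mult_left_le)
    finally show ?thesis .
  qed
  have "f summable_on A"
    by (rule nonneg_bdd_above_summable_on) (use f0 bound in \<open>auto intro!: bdd_aboveI\<close>)
  then have "(f has_sum Ssum ds x) A"
    unfolding Ssum_def A_def f_def[abs_def] by (rule has_sum_infsum)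
  then have "(sum f \<longlongrightarrow> Ssum ds x) (finite_subsets_at_top A)" by (simp add: has_sum_def)
  \<comment> \<open>The sets of placements among the first n coordinates eventually contain every
    finite subset of A, so the unordered sum is a limit along them.\<close>
  moreover have "filterlim L (finite_subsets_at_top A) sequentially"
    unfolding filterlim_finite_subsets_at_top eventually_sequentially
    using cover by (simp add: finL LA)
  ultimately have "(\<lambda>n. sum f (L n)) \<longlonglongrightarrow> Ssum ds x" by (rule filterlim_compose)
  then show ?thesis unfolding L_sum .
qed

lemma psum_bij:
  "bij_betw \<pi> K J \<Longrightarrow> psum d J xs = psum (\<lambda>k. d (\<pi> k)) K xs"
proof (induction xs arbitrary: J K)
  case Nil
  then show ?case by (auto simp: bij_betw_def)
next
  case (Cons y ys)
  have "(\<Sum>a\<in>J. y ^ d a * psum d (J - {a}) ys) = (\<Sum>k\<in>K. y ^ d (\<pi> k) * psum d (J - {\<pi> k}) ys)"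
    by (rule sum.reindex_bij_betw[OF Cons.prems, symmetric])
  also have "\<dots> = (\<Sum>k\<in>K. y ^ d (\<pi> k) * psum (\<lambda>k. d (\<pi> k)) (K - {k}) ys)"
  proof (intro sum.cong refl)
    fix k assume "k \<in> K"
    then have "bij_betw \<pi> (K - {k}) (J - {\<pi> k})"
      using bij_betw_DiffI[OF Cons.prems, of "{k}" "{\<pi> k}"] bij_betwE[OF Cons.prems] by simp
    then show "y ^ d (\<pi> k) * psum d (J - {\<pi> k}) ys = y ^ d (\<pi> k) * psum (\<lambda>k. d (\<pi> k)) (K - {k}) ys"
      using Cons.IH by metis
  qed
  finally show ?case using Cons.IH[OF Cons.prems] by simp
qed

lemma psum_cong: "(\<And>j. j \<in> J \<Longrightarrow> d j = d' j) \<Longrightarrow> psum d J xs = psum d' J xs"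
proof (induction xs arbitrary: J)
  case (Cons y ys)
  have "psum d (J - {a}) ys = psum d' (J - {a}) ys" for a using Cons by blast
  then show ?case using Cons by (auto intro!: sum.cong arg_cong2[where f = "(+)"])
qed simp

lemma psum_tendsto:
  assumes x: "\<And>i. 0 \<le> x i" "\<And>n. (\<Sum>i<n. x i) \<le> 1" and J: "finite J" "\<And>a. a \<in> J \<Longrightarrow> 1 \<le> d a"
  shows "(\<lambda>n. psum d J (map x [0..<n])) \<longlonglongrightarrow> Ssum (map d (sorted_list_of_set J)) x"
proof -
  define ks where "ks = sorted_list_of_set J"
  have "bij_betw ((!) ks) {..<length ks} J"
    unfolding ks_def using J(1) by (intro bij_betw_nth) auto
  then have "psum d J xs = psum (\<lambda>k. d (ks ! k)) {..<length ks} xs" for xs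
    by (rule psum_bij)
  also have "psum (\<lambda>k. d (ks ! k)) {..<length ks} xs
      = psum ((!) (map d ks)) {..<length (map d ks)} xs" for xs
    by (simp, rule psum_cong) simp
  finally have "psum d J xs = psum ((!) (map d ks)) {..<length (map d ks)} xs" for xs .
  moreover have "(\<lambda>n. psum ((!) (map d ks)) {..<length (map d ks)} (map x [0..<n])) \<longlonglongrightarrow> Ssum (map d ks) x"
    by (rule Ssum_tendsto[OF x]) (use J ks_def in auto)
  ultimately show ?thesis unfolding ks_def by simp
qed

section \<open>Spreading the mass x_0 over many equal entries\<close>

lemma psum_append:
  assumes "finite J"
  shows "psum d J (xs @ zs) = (\<Sum>K\<in>Pow J. psum d (J - K) xs * psum d K zs)"
  using assms
proof (induction xs arbitrary: J)
  case Nil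
  have "(\<Sum>K\<in>Pow J. psum d (J - K) [] * psum d K zs)
      = (\<Sum>K\<in>{J}. psum d (J - K) [] * psum d K zs)"
    using Nil by (intro sum.mono_neutral_right) auto
  then show ?case by simp
next
  case (Cons y ys)
  note fin = Cons.prems
  define h where "h a K = y ^ d a * (psum d (J - {a} - K) ys * psum d K zs)" for a K
  have "(\<Sum>a\<in>J. y ^ d a * psum d (J - {a}) (ys @ zs)) = (\<Sum>a\<in>J. \<Sum>K\<in>Pow (J - {a}). h a K)"
    unfolding h_def using Cons by (simp add: sum_distrib_left)
  also have "\<dots> = (\<Sum>a\<in>J. \<Sum>K | K \<in> Pow J \<and> a \<notin> K. h a K)"
    by (intro sum.cong refl) auto
  also have "\<dots> = (\<Sum>K\<in>Pow J. \<Sum>a | a \<in> J \<and> a \<notin> K. h a K)"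
    using fin by (intro sum.swap_restrict) auto
  also have "\<dots> = (\<Sum>K\<in>Pow J. (\<Sum>a\<in>J - K. y ^ d a * psum d (J - K - {a}) ys) * psum d K zs)"
  proof (intro sum.cong refl)
    fix K
    have "J - {a} - K = J - K - {a}" for a by auto
    then show "(\<Sum>a | a \<in> J \<and> a \<notin> K. h a K)
        = (\<Sum>a\<in>J - K. y ^ d a * psum d (J - K - {a}) ys) * psum d K zs"
      unfolding h_def sum_distrib_right by (intro sum.cong) auto
  qed
  finally show ?case
    using Cons.IH[OF fin] by (simp add: distrib_right sum.distrib)
qed

lemma prod_diff_over_power_tendsto_1:
  "(\<lambda>n. (\<Prod>i<k. real n - real i) / real n ^ k) \<longlonglongrightarrow> 1"
proof -
  have "(\<lambda>n. \<Prod>i<k. (real n - real i) / real n) \<longlonglongrightarrow> (\<Prod>i<k. 1)"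
  proof (intro tendsto_prod)
    fix i
    have "(\<lambda>n. 1 - real i / real n) \<longlonglongrightarrow> 1 - 0"
      by (intro tendsto_intros lim_const_over_n)
    moreover have "\<forall>\<^sub>F n in sequentially. 1 - real i / real n = (real n - real i) / real n"
      using eventually_gt_at_top[of 0] by eventually_elim (simp add: diff_divide_distrib)
    ultimately show "(\<lambda>n. (real n - real i) / real n) \<longlonglongrightarrow> 1"
      using tendsto_cong by fastforce
  qed
  then show ?thesis by (simp add: prod_dividef)
qed

text \<open>Placing K on n entries of size c / n gives about n^|K| (c / n)^D, where D is the total
  size of the parts in K. As D \<ge> |K| with equality only for parts of size one, all other cases
  vanish in the limit.\<close>

lemma psum_replicate_tendsto:
  assumes K: "finite K" "\<And>a. a \<in> K \<Longrightarrow> 1 \<le> d a" and c: "c \<longlonglongrightarrow> c0"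
  shows "(\<lambda>n. psum d K (replicate n (c n / real n)))
    \<longlonglongrightarrow> (if \<forall>a\<in>K. d a = 1 then c0 ^ card K else 0)"
proof -
  define D where "D = (\<Sum>a\<in>K. d a)"
  have DK: "card K \<le> D" unfolding D_def using sum_mono[of K "\<lambda>_. 1" d] K by simp
  have eq: "D = card K \<longleftrightarrow> (\<forall>a\<in>K. d a = 1)"
  proof
    assume "D = card K"
    then have "(\<Sum>a\<in>K. 1) = (\<Sum>a\<in>K. d a)" unfolding D_def by simp
    then show "\<forall>a\<in>K. d a = 1" using sum_mono_inv[of "\<lambda>_. 1" K d] K by force
  qed (simp add: D_def)
  have "psum d K (replicate n (c n / real n))
      = c n ^ D * ((\<Prod>i<card K. real n - real i) / real n ^ card K) * (1 / real n) ^ (D - card K)" for n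
  proof -
    have "real n ^ D = real n ^ card K * real n ^ (D - card K)"
      using DK by (simp flip: power_add)
    then show ?thesis using K(1) unfolding D_def
      by (simp add: psum_replicate power_divide)
  qed
  moreover have "(\<lambda>n. c n ^ D * ((\<Prod>i<card K. real n - real i) / real n ^ card K) * (1 / real n) ^ (D - card K))
      \<longlonglongrightarrow> c0 ^ D * 1 * 0 ^ (D - card K)"
    by (intro tendsto_intros c prod_diff_over_power_tendsto_1 lim_const_over_n)
  moreover have "c0 ^ D * 1 * 0 ^ (D - card K) = (if \<forall>a\<in>K. d a = 1 then c0 ^ card K else 0)"
    using eq DK by auto
  ultimately show ?thesis by simp
qed

lemma sum_Pow_card:
  assumes "finite S"
  shows "(\<Sum>K\<in>Pow S. h (card K)) = (\<Sum>i\<le>card S. real (card S choose i) * h i)"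
proof -
  have "(\<Sum>i\<le>card S. sum (\<lambda>K. h (card K)) {K \<in> Pow S. card K = i}) = (\<Sum>K\<in>Pow S. h (card K))"
    using assms by (intro sum.group) (auto simp: card_mono)
  moreover have "sum (\<lambda>K. h (card K)) {K \<in> Pow S. card K = i} = real (card S choose i) * h i" for i
    using n_subsets[OF assms, of i] by simp
  ultimately show ?thesis by (simp only:)
qed

lemma sum_lessThan_le_1: "x \<in> Pbar \<Longrightarrow> (\<Sum>i<n. x i) \<le> 1"
  using sum_le_suminf[of x "{..<n}"] unfolding Pbar_def by force

lemma ones_eq:
  assumes "valid_parts a"
  shows "{j. j < length a \<and> a ! j = 1} = {length a - sc a..<length a}" "sc a \<le> length a"
proof -
  define S where "S = {j. j < length a \<and> a ! j = 1}"
  have card: "card S = sc a"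
    unfolding S_def sc_def by (simp add: length_filter_conv_card)
  have fin: "finite S" unfolding S_def by simp
  have "S = {length a - card S..<length a}"
  proof (cases "S = {}")
    case False
    define p where "p = Min S"
    have p: "p \<in> S" "\<And>j. j \<in> S \<Longrightarrow> p \<le> j" unfolding p_def using False fin by auto
    have "a ! j = 1" if "p \<le> j" "j < length a" for j
    proof -
      have "a ! j \<le> a ! p"
        using assms that sorted_wrt_nth_less[of "(\<ge>)" a p j] unfolding valid_parts_def
        by (cases "p = j") auto
      moreover have "1 \<le> a ! j" using assms that unfolding valid_parts_def by simp
      ultimately show ?thesis using p(1) unfolding S_def by simp
    qed
    then have "{p..<length a} \<subseteq> S" unfolding S_def by auto
    moreover have "S \<subseteq> {p..<length a}"
    proof
      fix j assume j: "j \<in> S"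
      then have "j < length a" unfolding S_def by simp
      then show "j \<in> {p..<length a}" using p(2)[OF j] by simp
    qed
    ultimately have "S = {p..<length a}" by blast
    moreover have "p < length a" using p unfolding S_def by auto
    ultimately show ?thesis by simp
  qed simp
  then show "{j. j < length a \<and> a ! j = 1} = {length a - sc a..<length a}"
    unfolding card S_def[symmetric] by simp
  show "sc a \<le> length a" unfolding sc_def by simp
qed

text \<open>Parts of size one are interchangeable, so removing any set K of them amounts to cutting
  off the last |K| parts, which is what \<open>take\<close> does in \<open>pF\<close>.\<close>

lemma psum_delete_ones:
  assumes a: "valid_parts a" and K: "K \<subseteq> {j. j < length a \<and> a ! j = 1}"
  shows "psum ((!) a) ({..<length a} - K) xs
       = psum ((!) (take (length a - card K) a)) {..<length (take (length a - card K) a)} xs"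
proof -
  define r where "r = length a"
  define s where "s = sc a"
  have s: "s \<le> r" and ones: "{j. j < r \<and> a ! j = 1} = {r - s..<r}"
    using ones_eq[OF a] unfolding r_def s_def by auto
  have K: "K \<subseteq> {r - s..<r}" using K ones unfolding r_def by simp
  have one: "a ! j = 1" if "r - s \<le> j" "j < r" for j
    using that ones by (metis (mono_tags, lifting) atLeastLessThan_iff mem_Collect_eq)
  have finK: "finite K" using K finite_subset by blast
  have cK: "card K \<le> s" using card_mono[OF _ K] s by simp
  have "card ({r - s..<r} - K) = card {r - s..<r - card K}"
    using K finK s cK by (simp add: card_Diff_subset)
  then obtain f where f: "bij_betw f {r - s..<r - card K} ({r - s..<r} - K)"
    using finite_same_card_bij by (metis finite_Diff finite_atLeastLessThan)
  \<comment> \<open>The parts larger than one stay in place; the surviving parts of size one are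
    matched arbitrarily with the first remaining positions.\<close>
  define \<pi> where "\<pi> j = (if j < r - s then j else f j)" for j
  have "bij_betw \<pi> {..<r - s} {..<r - s}"
    by (rule iffD2[OF bij_betw_cong bij_betw_id[unfolded id_def]]) (simp add: \<pi>_def)
  moreover have "bij_betw \<pi> {r - s..<r - card K} ({r - s..<r} - K)"
    by (rule iffD2[OF bij_betw_cong f]) (simp add: \<pi>_def)
  ultimately have "bij_betw \<pi> ({..<r - s} \<union> {r - s..<r - card K}) ({..<r - s} \<union> ({r - s..<r} - K))"
    by (rule bij_betw_combine) auto
  moreover have "{..<r - s} \<union> {r - s..<r - card K} = {..<r - card K}" using cK s by auto
  moreover have "{..<r - s} \<union> ({r - s..<r} - K) = {..<r} - K" using K s by auto
  ultimately have bij: "bij_betw \<pi> {..<r - card K} ({..<r} - K)" by simp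
  have "psum ((!) a) ({..<r} - K) xs = psum (\<lambda>k. a ! \<pi> k) {..<r - card K} xs"
    by (rule psum_bij[OF bij])
  also have "\<dots> = psum ((!) (take (r - card K) a)) {..<r - card K} xs"
  proof (rule psum_cong)
    fix j assume j: "j \<in> {..<r - card K}"
    show "a ! \<pi> j = take (r - card K) a ! j"
    proof (cases "j < r - s")
      case False
      then have "f j \<in> {r - s..<r}" using f j unfolding bij_betw_def by auto
      then show ?thesis using False j one[of "f j"] one[of j] unfolding \<pi>_def by simp
    qed (use j in \<open>simp add: \<pi>_def\<close>)
  qed
  finally show ?thesis unfolding r_def by simp
qed

text \<open>The mass \<open>x\<^sub>0\<close> is spread evenly over \<open>n\<close> new coordinates. In the limit such a
  coordinate carries at most one vertex, so it can only host a part of size one.\<close>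

lemma pF_tendsto:
  assumes a: "valid_parts a" and x: "x \<in> Pbar"
  shows "(\<lambda>n. kappa a * psum ((!) a) {..<length a}
            (map x [0..<n] @ replicate n ((1 - (\<Sum>i<n. x i)) / real n))) \<longlonglongrightarrow> pF a x"
proof -
  define r where "r = length a"
  define d where "d = (!) a"
  define S where "S = {j. j < length a \<and> a ! j = 1}"
  define c where "c n = 1 - (\<Sum>i<n. x i)" for n
  have d1: "1 \<le> d j" if "j < r" for j using a that unfolding d_def r_def valid_parts_def by simp
  have x0: "\<And>i. 0 \<le> x i" using x unfolding Pbar_def by auto
  have x1: "\<And>n. (\<Sum>i<n. x i) \<le> 1" using x by (rule sum_lessThan_le_1)
  have c: "c \<longlonglongrightarrow> xzero x"
    unfolding c_def xzero_def using x by (intro tendsto_intros summable_LIMSEQ) (auto simp: Pbar_def)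
  define T where "T K = Ssum (map d (sorted_list_of_set ({..<r} - K))) x" for K
  define E where "E K = (if \<forall>a\<in>K. d a = 1 then xzero x ^ card K else 0)" for K
  have T: "(\<lambda>n. psum d ({..<r} - K) (map x [0..<n])) \<longlonglongrightarrow> T K" for K
    unfolding T_def by (rule psum_tendsto[OF x0 x1]) (use d1 in auto)
  have "(\<lambda>n. \<Sum>K\<in>Pow {..<r}. psum d ({..<r} - K) (map x [0..<n]) * psum d K (replicate n (c n / real n)))
      \<longlonglongrightarrow> (\<Sum>K\<in>Pow {..<r}. T K * E K)"
  proof (intro tendsto_sum tendsto_mult T)
    fix K assume K: "K \<in> Pow {..<r}"
    then show "(\<lambda>n. psum d K (replicate n (c n / real n))) \<longlonglongrightarrow> E K"
      unfolding E_def by (intro psum_replicate_tendsto c) (use d1 finite_subset in auto)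
  qed
  \<comment> \<open>A set K with a part larger than one has E K = 0.\<close>
  moreover have "(\<Sum>K\<in>Pow {..<r}. T K * E K) = (\<Sum>K\<in>Pow S. T K * E K)"
    by (rule sum.mono_neutral_right) (auto simp: S_def r_def E_def d_def)
  moreover have "(\<Sum>K\<in>Pow S. T K * E K) = (\<Sum>K\<in>Pow S. xzero x ^ card K * Ssum (take (length a - card K) a) x)"
  proof (intro sum.cong refl)
    fix K assume K: "K \<in> Pow S"
    have "(\<lambda>n. psum d ({..<r} - K) (map x [0..<n])) \<longlonglongrightarrow> Ssum (take (length a - card K) a) x"
      unfolding d_def r_def using psum_delete_ones[OF a, of K] K unfolding S_def
      by simp (rule Ssum_tendsto[OF x0 x1, of "take (length a - card K) a", simplified],
          use a in \<open>auto simp: valid_parts_def dest: in_set_takeD\<close>)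
    then have "T K = Ssum (take (length a - card K) a) x" using T LIMSEQ_unique by blast
    moreover have "E K = xzero x ^ card K" unfolding E_def using K by (auto simp: S_def d_def)
    ultimately show "T K * E K = xzero x ^ card K * Ssum (take (length a - card K) a) x" by simp
  qed
  \<comment> \<open>The summand depends on K through its size only, which produces the binomial
    coefficients of \<open>pF\<close>.\<close>
  moreover have "\<dots> = (\<Sum>i\<le>card S. real (card S choose i) * (xzero x ^ i * Ssum (take (length a - i) a) x))"
    by (rule sum_Pow_card) (simp add: S_def)
  moreover have "card S = sc a"
    unfolding S_def sc_def by (simp add: length_filter_conv_card)
  moreover have "psum d {..<r} (map x [0..<n] @ replicate n (c n / real n))
      = (\<Sum>K\<in>Pow {..<r}. psum d ({..<r} - K) (map x [0..<n]) * psum d K (replicate n (c n / real n)))" for n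
    by (rule psum_append) simp
  ultimately have "(\<lambda>n. psum d {..<r} (map x [0..<n] @ replicate n (c n / real n)))
      \<longlonglongrightarrow> (\<Sum>i\<le>sc a. real (sc a choose i) * xzero x ^ i * Ssum (take (length a - i) a) x)"
    by (simp add: mult.assoc)
  then show ?thesis unfolding pF_def d_def r_def c_def by (rule tendsto_mult_left)
qed

text \<open>The approximating sequence of \<open>pF_tendsto\<close> is constant from n = k on: no
  mass is left to spread and all further entries are 0.\<close>

lemma pF_simp_k:
  assumes a: "valid_parts a" and x: "x \<in> simp_k k"
  shows "pF a x = kappa a * psum ((!) a) {..<length a} (map x [0..<k])"
proof -
  define d where "d = (!) a"
  define J where "J = {..<length a}"
  have J: "finite J" "\<And>j. j \<in> J \<Longrightarrow> 1 \<le> d j"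
    using a unfolding d_def J_def valid_parts_def by auto
  have xP: "x \<in> Pbar" and xk: "\<And>i. k \<le> i \<Longrightarrow> x i = 0" "(\<Sum>i<k. x i) = 1"
    using x unfolding simp_k_def by auto
  have "psum d J (map x [0..<n] @ replicate n ((1 - (\<Sum>i<n. x i)) / real n)) = psum d J (map x [0..<k])"
    if n: "k \<le> n" for n
  proof -
    have "(\<Sum>i<n. x i) = (\<Sum>i<k. x i)"
      using n xk(1) by (intro sum.mono_neutral_right) auto
    moreover have "map x [0..<n] = map x [0..<k] @ replicate (n - k) 0"
      using n xk(1) by (intro nth_equalityI) (auto simp: nth_append)
    moreover have "psum d J (map x [0..<k] @ replicate (n - k + n) 0) = psum d J (map x [0..<k])"
      using J(2,1) by (rule psum_append_zeros)
    ultimately show ?thesis using xk(2) by (simp add: replicate_add)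
  qed
  then have "(\<lambda>n. kappa a * psum d J (map x [0..<n] @ replicate n ((1 - (\<Sum>i<n. x i)) / real n)))
     \<longlonglongrightarrow> kappa a * psum d J (map x [0..<k])"
    by (intro tendsto_eventually eventually_sequentiallyI[of k]) simp
  then show ?thesis using pF_tendsto[OF a xP] LIMSEQ_unique unfolding d_def J_def by blast
qed

section \<open>The set of maximisers\<close>

lemma Pbar_antimono: "x \<in> Pbar \<Longrightarrow> i \<le> j \<Longrightarrow> x j \<le> x i"
  unfolding Pbar_def using decseqD[OF decseq_SucI, of x i j] by auto

lemma kvec_in_simp_k:
  assumes "1 \<le> j" "j \<le> k"
  shows "kvec j \<in> simp_k k"
proof -
  have s: "(\<Sum>i<n. kvec j i) = 1" if "j \<le> n" for n
  proof -
    have "(\<Sum>i<n. kvec j i) = (\<Sum>i<j. kvec j i)"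
      using that by (intro sum.mono_neutral_right) (auto simp: kvec_def)
    then show ?thesis using assms by (simp add: kvec_def)
  qed
  have "kvec j sums (\<Sum>i<j. kvec j i)"
    by (rule sums_finite) (auto simp: kvec_def)
  then have "kvec j sums 1" using s by simp
  then have "summable (kvec j)" "suminf (kvec j) = 1" by (auto simp: sums_iff)
  then show ?thesis
    unfolding simp_k_def Pbar_def using s[OF assms(2)] assms(2) by (auto simp: kvec_def)
qed

lemma pF_kvec:
  assumes "valid_parts a" "1 \<le> length a" "1 \<le> j"
  shows "pF a (kvec j) = kappa a * ffun (length a) (ell a) j"
proof -
  have "map (kvec j) [0..<j] = replicate j (1 / real j)"
    by (intro nth_equalityI) (auto simp: kvec_def)
  then have eq: "pF a (kvec j) = kappa a * psum ((!) a) {..<length a} (replicate j (1 / real j))"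
    using pF_simp_k[OF assms(1) kvec_in_simp_k[OF assms(3) order_refl]] by simp
  have l: "(\<Sum>i<length a. a ! i) = ell a" unfolding ell_def by (simp add: sum_list_sum_nth lessThan_atLeast0)
  have "a ! 0 \<in> set a" using assms(2) by (cases a) auto
  then have "1 \<le> a ! 0" using assms(1) unfolding valid_parts_def by blast
  also have "\<dots> \<le> (\<Sum>i<length a. a ! i)" using assms(2) by (intro member_le_sum) auto
  finally have "1 \<le> ell a" using l by simp
  then show ?thesis
    unfolding eq using assms l psum_uniform_value[of "{..<length a}" "length a" "(!) a" "ell a" j] by simp
qed

text \<open>Both a point of the finite simplex and its discrete approximations (with the
  mass \<open>x\<^sub>0\<close> cut into \<open>p\<close> pieces of size \<open>c\<close>) meet the hypotheses of the gap
  estimate with a common \<open>g\<close>, unless the point is uniform.\<close>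

lemma Pbar_gap:
  assumes x: "x \<in> Pbar" and pos: "0 < x 0" and nu: "\<And>j. 1 \<le> j \<Longrightarrow> x \<noteq> kvec j"
  obtains g j where "0 < g" "\<And>k. (\<forall>i\<ge>k. x i = 0) \<Longrightarrow> j \<le> k"
    "\<And>n p c. j \<le> n \<Longrightarrow> 0 \<le> c \<Longrightarrow> c \<le> x 0 / 2 \<Longrightarrow> real p * c = 1 - (\<Sum>i<n. x i) \<Longrightarrow>
       gap_list g (x 0) (map x [0..<n] @ replicate p c)"
proof -
  define s where "s = x 0"
  have nn: "0 \<le> x i" for i using x unfolding Pbar_def by auto
  have "summable x" using x unfolding Pbar_def by auto
  then have "x \<longlonglongrightarrow> 0" by (rule summable_LIMSEQ_zero)
  then have "\<forall>\<^sub>F i in sequentially. x i < s" using pos unfolding s_def by (rule order_tendstoD(2))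
  then obtain i where i: "x i < s" unfolding eventually_sequentially by blast
  \<comment> \<open>As x tends to 0 and x 0 is positive, only finitely many entries equal the
    largest one; j is their number.\<close>
  define j where "j = (LEAST i. x i < s)"
  have j: "x j < s" unfolding j_def using i by (rule LeastI)
  have top: "x i = s" if "i < j" for i
    using not_less_Least[of i "\<lambda>i. x i < s"] Pbar_antimono[OF x, of 0 i] that
    unfolding j_def s_def by simp
  have low: "x i \<le> x j" if "j \<le> i" for i using Pbar_antimono[OF x that] .
  have j1: "1 \<le> j" using j unfolding s_def by (cases j) auto
  have js: "(\<Sum>i<j. x i) = real j * s" using top by simp
  have js1: "real j * s \<le> 1" using sum_lessThan_le_1[OF x, of j] js by simp
  \<comment> \<open>Otherwise the first j entries carry all the mass and x is uniform.\<close>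
  have "real j * s \<noteq> 1"
  proof
    assume eq: "real j * s = 1"
    have "x i = kvec j i" for i
    proof (cases "i < j")
      case True
      then show ?thesis using top eq j1 unfolding kvec_def by (simp add: field_simps)
    next
      case False
      have "(\<Sum>k<j. x k) + x i = (\<Sum>k\<in>insert i {..<j}. x k)" using False by simp
      also have "\<dots> \<le> (\<Sum>k<Suc i. x k)" using False nn by (intro sum_mono2) auto
      also have "\<dots> \<le> 1" by (rule sum_lessThan_le_1[OF x])
      finally show ?thesis using js eq nn[of i] False unfolding kvec_def by simp
    qed
    then show False using nu[OF j1] by blast
  qed
  then have js1: "real j * s < 1" using js1 by simp
  \<comment> \<open>The three terms are the mass away from s, the distance from s to the next value,
    and the distance that a piece of size at most s / 2 keeps from s.\<close>
  define g where "g = min (1 - real j * s) (min (s - x j) (s / 2))"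
  have g: "0 < g" "g \<le> 1 - real j * s" "g \<le> s - x j" "g \<le> s / 2"
    unfolding g_def using js1 j pos unfolding s_def[symmetric] by linarith+
  show ?thesis
  proof (rule that[of g j])
    show "j \<le> k" if k: "\<forall>i\<ge>k. x i = 0" for k
    proof (rule ccontr)
      assume "\<not> j \<le> k"
      then have "x k = s" using top by simp
      then show False using k pos unfolding s_def by simp
    qed
  next
    fix n p c
    assume n: "j \<le> n" and c: "0 \<le> c" "c \<le> x 0 / 2" and pc: "real p * c = 1 - (\<Sum>i<n. x i)"
    define zs where "zs = map x [0..<n] @ replicate p c"
    have "sum_list zs = 1" unfolding zs_def using pc by (simp add: sum_list_map_upt sum_list_replicate)
    moreover have "0 \<le> e" if "e \<in> set zs" for e using that nn c unfolding zs_def by auto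
    ultimately have 1: "prob_list zs" unfolding prob_list_def by simp
    have "0 < n" using n j1 by simp
    then have 2: "s \<in> set zs" unfolding zs_def s_def by force
    have cs: "c + g \<le> s" using c g(4) unfolding s_def by simp
    have xs: "x i = s \<or> x i + g \<le> s" for i
      using top[of i] low[of i] g(3) by (cases "i < j") auto
    have 3: "\<forall>e\<in>set zs. e = s \<or> e + g \<le> s"
      unfolding zs_def using cs xs by auto
    have "[0..<n] = [0..<j] @ [j..<n]" using n upt_add_eq_append[of 0 j "n - j"] by simp
    then have "map x [0..<n] = replicate j s @ map x [j..<n]"
      using top by (simp add: map_replicate_const[symmetric] map_eq_conv) (auto intro: nth_equalityI)
    then have zs: "zs = replicate j s @ map x [j..<n] @ replicate p c"
      unfolding zs_def by simp
    have "filter (\<lambda>e. e \<noteq> s) (map x [j..<n]) = map x [j..<n]"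
      using low j by (intro filter_True) force
    then have "filter (\<lambda>e. e \<noteq> s) zs = map x [j..<n] @ replicate p c"
      unfolding zs using cs g(1) by auto
    moreover have "sum_list zs = real j * s + sum_list (map x [j..<n] @ replicate p c)"
      unfolding zs by (simp add: sum_list_replicate)
    ultimately have "g \<le> sum_list (filter (\<lambda>e. e \<noteq> s) zs)"
      using \<open>sum_list zs = 1\<close> g(2) by simp
    with 1 2 3 have "gap_list g s zs" unfolding gap_list_def by blast
    then show "gap_list g (x 0) (map x [0..<n] @ replicate p c)" unfolding zs_def s_def .
  qed (rule g)
qed

lemma kappa_pos: "0 < kappa a"
proof -
  have "0 < (\<Prod>v\<leftarrow>a. fact v :: real)" by (induction a) auto
  moreover have "0 < sym_factor a" unfolding sym_factor_def by (intro prod_pos) auto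
  ultimately show ?thesis unfolding kappa_def by simp
qed

lemma almost_balanced_parts:
  assumes a: "valid_parts a" "almost_balanced a" and "i < length a" "j < length a"
  shows "(a ! i - a ! j) choose 2 < a ! j"
proof -
  have ne: "a \<noteq> []" using assms by auto
  have mono: "a ! q \<le> a ! p" if "p \<le> q" "q < length a" for p q
    using a(1) sorted_wrt_nth_less[of "(\<ge>)" a p q] that unfolding valid_parts_def
    by (cases "p = q") auto
  have "a ! i \<le> hd a" using mono[of 0 i] assms ne by (simp add: hd_conv_nth)
  moreover have "last a \<le> a ! j" using mono[of j "length a - 1"] assms ne by (simp add: last_conv_nth)
  ultimately have "(a ! i - a ! j) choose 2 \<le> (hd a - last a) choose 2"
    by (intro binomial_right_mono) linarith
  also have "\<dots> < last a" using a(2) unfolding almost_balanced_def by simp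
  also have "\<dots> \<le> a ! j" by fact
  finally show ?thesis .
qed

lemma sc_less_length:
  assumes "almost_balanced a"
  shows "sc a < length a"
proof -
  obtain v where "v \<in> set a" "v \<noteq> 1" using assms unfolding almost_balanced_def is_complete_def by auto
  then show ?thesis unfolding sc_def by (intro length_filter_less)
qed

text \<open>The origin, with all mass in x_0, has no positive entry from which merging could start.
  As F is not complete, every term of p_F still places at least one part on the coordinates, so it
  vanishes.\<close>

lemma pF_zero:
  assumes "valid_parts a" "almost_balanced a" "\<And>i. x i = 0"
  shows "pF a x = 0"
proof -
  have "Ssum ds x = 0" if ds: "ds \<noteq> []" "\<And>v. v \<in> set ds \<Longrightarrow> 1 \<le> v" for ds
  proof -
    have "(\<Prod>j<length ds. x (is ! j) ^ (ds ! j)) = 0" for "is"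
    proof (rule prod_zero)
      have "1 \<le> ds ! 0" using ds by simp
      then show "\<exists>j\<in>{..<length ds}. x (is ! j) ^ (ds ! j) = 0"
        using ds(1) assms(3) by (intro bexI[of _ 0]) auto
    qed simp
    then show ?thesis unfolding Ssum_def by (simp only: infsum_0_simp)
  qed
  moreover have "take (length a - i) a \<noteq> []" if "i \<le> sc a" for i
    using sc_less_length[OF assms(2)] that by auto
  moreover have "1 \<le> v" if "v \<in> set (take (length a - i) a)" for i v
    using assms(1) that in_set_takeD unfolding valid_parts_def by fast
  ultimately have "(\<Sum>i\<le>sc a. real (sc a choose i) * xzero x ^ i * Ssum (take (length a - i) a) x) = 0"
    by (intro sum.neutral) auto
  then show ?thesis unfolding pF_def by simp
qed

lemma OPT_on_unique:
  assumes "x \<in> S" "\<And>y. y \<in> S \<Longrightarrow> y \<noteq> x \<Longrightarrow> pF a y < pF a x"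
  shows "OPT_on a S = {x} \<and> is_max_value a S (pF a x)"
proof -
  have le: "pF a y \<le> pF a x" if "y \<in> S" for y using assms(2)[OF that] by (cases "y = x") auto
  have "y = x" if "y \<in> OPT_on a S" for y
    using that assms unfolding OPT_on_def by force
  then show ?thesis using assms(1) le unfolding OPT_on_def is_max_value_def by blast
qed

lemma ffun_falling:
  assumes "1 \<le> r" "r \<le> k"
  shows "ffun r l k = falling (int k - 1) (r - 1) / real k ^ (l - 1)"
proof -
  have "(\<Prod>i\<in>{1..<r}. real k - real i) = (\<Prod>i<r - 1. real_of_int (int k - 1 - int i))"
    by (rule prod.reindex_bij_witness[where i = Suc and j = "\<lambda>i. i - 1"]) auto
  then show ?thesis using assms unfolding ffun_def falling_def by simp
qed

theorem theorem3p1: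
  fixes a :: "nat list" and r l m :: nat
  assumes "length a = r" and "valid_parts a" and "l = ell a"
    and "l > r" and "r \<ge> 2" and "almost_balanced a" and "m = m_rl r l"
  shows "(\<forall>k. r \<le> k \<and> k < m \<longrightarrow>
            OPT_k a k = {kvec k} \<and>
            is_max_value a (simp_k k) (kappa a * falling (int k - 1) (r - 1) / real k ^ (l - 1)))
       \<and> (\<forall>k. m \<le> k \<longrightarrow>
            OPT_k a k = {kvec m} \<and>
            is_max_value a (simp_k k) (kappa a * falling (int m - 1) (r - 1) / real m ^ (l - 1)))
       \<and> OPT a = {kvec m}
       \<and> is_max_value a Pbar (kappa a * falling (int m - 1) (r - 1) / real m ^ (l - 1))"
proof -
  note uni = ffun_unimodal[OF assms(5,4), folded assms(7)]
  define d where "d = (!) a"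
  define J where "J = {..<r}"
  have J: "finite J" "card J = r" "2 \<le> card J" using assms(5) unfolding J_def by auto
  have l: "(\<Sum>i\<in>J. d i) = l"
    unfolding d_def J_def assms(3) ell_def using assms(1) by (simp add: sum_list_sum_nth lessThan_atLeast0)
  have bal: "(d p - d q) choose 2 < d q" if "p \<in> J" "q \<in> J" for p q
    using almost_balanced_parts[OF assms(2,6)] that unfolding d_def J_def assms(1) by simp
  have pF_k: "pF a (kvec j) = kappa a * ffun r l j" if "1 \<le> j" for j
    using pF_kvec[OF assms(2) _ that] assms(1,3,5) by simp
  have val: "pF a (kvec k) = kappa a * falling (int k - 1) (r - 1) / real k ^ (l - 1)" if "r \<le> k" for k
    using pF_k ffun_falling[OF _ that, of l] assms(5) that by simp
  \<comment> \<open>Used with N = k while f still rises up to k, and with N = m once m \<le>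
    k.\<close>
  have finite_case: "OPT_k a k = {kvec N} \<and>
      is_max_value a (simp_k k) (kappa a * falling (int N - 1) (r - 1) / real N ^ (l - 1))"
    if N: "r \<le> N" "N \<le> k" and best: "\<And>j. 1 \<le> j \<Longrightarrow> j \<le> k \<Longrightarrow> j \<noteq> N \<Longrightarrow> ffun r l j < ffun r l N"
    for k N
  proof -
    have Npos: "0 < ffun r l N" using ffun_pos N(1) assms(5) by simp
    have M: "psum d J ys \<le> ffun r l N" if "prob_list ys" "length ys \<le> k" for ys
    proof (rule psum_le[OF J(2) assms(5) l bal _ that])
      show "ffun r l j \<le> ffun r l N" if "1 \<le> j" "j \<le> k" for j
        using best[OF that] by (cases "j = N") auto
    qed
    have "pF a x < pF a (kvec N)" if x: "x \<in> simp_k k" "x \<noteq> kvec N" for x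
    proof -
      have xP: "x \<in> Pbar" and xk: "\<forall>i\<ge>k. x i = 0" "(\<Sum>i<k. x i) = 1"
        using x(1) unfolding simp_k_def by auto
      have pos: "0 < x 0"
      proof (rule ccontr)
        assume "\<not> 0 < x 0"
        then have "x i \<le> 0" for i using Pbar_antimono[OF xP, of 0 i] by simp
        then have "(\<Sum>i<k. x i) \<le> 0" by (intro sum_nonpos) auto
        then show False using xk by simp
      qed
      show ?thesis
      proof (cases "\<exists>j\<ge>1. x = kvec j")
        case True
        then obtain j where j: "1 \<le> j" "x = kvec j" by blast
        have "j \<le> k"
        proof (rule ccontr)
          assume "\<not> j \<le> k"
          then have "x k \<noteq> 0" unfolding j(2) kvec_def by simp
          then show False using xk(1) by simp
        qed
        then have "ffun r l j < ffun r l N" using best j x(2) by auto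
        then show ?thesis unfolding j(2) using pF_k j(1) N(1) assms(5) kappa_pos by simp
      next
        case False
        then have nu: "x \<noteq> kvec j" if "1 \<le> j" for j using that by blast
        obtain g j where g: "0 < g" "\<And>k. (\<forall>i\<ge>k. x i = 0) \<Longrightarrow> j \<le> k"
          "\<And>n p c. j \<le> n \<Longrightarrow> 0 \<le> c \<Longrightarrow> c \<le> x 0 / 2 \<Longrightarrow> real p * c = 1 - (\<Sum>i<n. x i) \<Longrightarrow>
             gap_list g (x 0) (map x [0..<n] @ replicate p c)"
          by (rule Pbar_gap[OF xP pos]) (erule nu, rule that)
        \<comment> \<open>A point of the finite simplex has no mass left to cut, so n = k and p = 0
          are taken.\<close>
        have "gap_list g (x 0) (map x [0..<k])"
          using g(3)[of k 0 0] g(2)[OF xk(1)] pos xk(2) by simp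
        then have "psum d J (map x [0..<k]) \<le> ffun r l N * (1 - exp (- 4 / g))"
          using psum_gap[OF J(1,3) bal M g(1)] by simp
        also have "\<dots> < ffun r l N" using Npos by simp
        finally show ?thesis
          using pF_simp_k[OF assms(2) x(1)] pF_k[of N] N(1) assms(1,5) kappa_pos
          unfolding d_def J_def by simp
      qed
    qed
    moreover have "kvec N \<in> simp_k k" using kvec_in_simp_k N assms(5) by simp
    ultimately have "OPT_on a (simp_k k) = {kvec N} \<and> is_max_value a (simp_k k) (pF a (kvec N))"
      by (intro OPT_on_unique)
    then show ?thesis unfolding OPT_k_def val[OF N(1)] .
  qed
  have "OPT a = {kvec m} \<and>
      is_max_value a Pbar (kappa a * falling (int m - 1) (r - 1) / real m ^ (l - 1))"
  proof -
    have mpos: "0 < ffun r l m" using ffun_pos uni(1) assms(5) by simp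
    \<comment> \<open>No length restriction appears: the approximating lists have 2 n entries with n
      unbounded.\<close>
    have M: "psum d J ys \<le> ffun r l m" if "prob_list ys" for ys
    proof (rule psum_le[OF J(2) assms(5) l bal _ that order_refl])
      show "ffun r l j \<le> ffun r l m" if "1 \<le> j" for j
        using uni(2)[OF that] by (cases "j = m") auto
    qed
    have pFm: "pF a (kvec m) = kappa a * ffun r l m" using pF_k uni(1) assms(5) by simp
    have "pF a x < pF a (kvec m)" if x: "x \<in> Pbar" "x \<noteq> kvec m" for x
    proof -
      have nn: "0 \<le> x i" for i using x(1) unfolding Pbar_def by auto
      consider "x 0 = 0" | (unif) j where "1 \<le> j" "x = kvec j"
        | (gap) "0 < x 0" "\<And>j. 1 \<le> j \<Longrightarrow> x \<noteq> kvec j"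
        using nn[of 0] by fastforce
      then show ?thesis
      proof cases
        case 1
        then have "x i = 0" for i using Pbar_antimono[OF x(1), of 0 i] nn[of i] by simp
        then have "pF a x = 0" by (rule pF_zero[OF assms(2,6)])
        then show ?thesis using pFm mpos kappa_pos by simp
      next
        case unif
        then have "ffun r l j < ffun r l m" using uni(2) x(2) by auto
        then show ?thesis unfolding unif(2) pFm using pF_k unif(1) kappa_pos by simp
      next
        case gap
        obtain g j where g: "0 < g" "\<And>k. (\<forall>i\<ge>k. x i = 0) \<Longrightarrow> j \<le> k"
          "\<And>n p c. j \<le> n \<Longrightarrow> 0 \<le> c \<Longrightarrow> c \<le> x 0 / 2 \<Longrightarrow> real p * c = 1 - (\<Sum>i<n. x i) \<Longrightarrow>
             gap_list g (x 0) (map x [0..<n] @ replicate p c)"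
          by (rule Pbar_gap[OF x(1) gap(1)]) (erule gap(2), rule that)
        \<comment> \<open>The pieces have size at most 1 / n, so eventually they are below x 0 / 2,
          as the gap estimate requires.\<close>
        define c where "c n = (1 - (\<Sum>i<n. x i)) / real n" for n
        \<comment> \<open>This bound does not depend on n, so the strict distance from the maximum
          survives the limit.\<close>
        define B where "B = ffun r l m * (1 - exp (- 4 / g))"
        have "\<forall>\<^sub>F n in sequentially. 1 / real n < x 0 / 2"
          by (rule order_tendstoD(2)[OF lim_const_over_n]) (use gap in auto)
        then have "\<forall>\<^sub>F n in sequentially. psum d J (map x [0..<n] @ replicate n (c n)) \<le> B"
          using eventually_ge_at_top[of j] eventually_gt_at_top[of 0]
        proof eventually_elim
          case (elim n)
          have "0 \<le> c n" unfolding c_def using sum_lessThan_le_1[OF x(1), of n] by simp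
          moreover have "c n \<le> 1 / real n"
            unfolding c_def using nn by (intro divide_right_mono) (auto intro!: sum_nonneg)
          moreover have "real n * c n = 1 - (\<Sum>i<n. x i)" unfolding c_def using elim by simp
          ultimately have gl: "gap_list g (x 0) (map x [0..<n] @ replicate n (c n))"
            using g(3)[of n "c n" n] elim by simp
          show ?case unfolding B_def
            by (rule psum_gap[OF J(1,3) bal M g(1) gl order_refl])
        qed
        then have ev: "\<forall>\<^sub>F n in sequentially.
            kappa a * psum d J (map x [0..<n] @ replicate n (c n)) \<le> kappa a * B"
          by eventually_elim (use kappa_pos[of a] in simp)
        have "pF a x \<le> kappa a * B"
          by (rule tendsto_upperbound[OF pF_tendsto[OF assms(2) x(1), unfolded assms(1)]])
             (use ev in \<open>auto simp: d_def J_def c_def\<close>)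
        also have "\<dots> < kappa a * ffun r l m" unfolding B_def using mpos kappa_pos by simp
        finally show ?thesis unfolding pFm .
      qed
    qed
    moreover have "kvec m \<in> Pbar"
      using kvec_in_simp_k[of m m] uni(1) assms(5) unfolding simp_k_def by simp
    ultimately have "OPT_on a Pbar = {kvec m} \<and> is_max_value a Pbar (pF a (kvec m))"
      by (intro OPT_on_unique)
    then show ?thesis unfolding Defs.OPT_def val[OF uni(1)] .
  qed
  moreover have "OPT_k a k = {kvec k} \<and>
      is_max_value a (simp_k k) (kappa a * falling (int k - 1) (r - 1) / real k ^ (l - 1))"
    if "r \<le> k" "k < m" for k
    by (rule finite_case) (use uni(3) that in auto)
  moreover have "OPT_k a k = {kvec m} \<and>
      is_max_value a (simp_k k) (kappa a * falling (int m - 1) (r - 1) / real m ^ (l - 1))"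
    if "m \<le> k" for k
    by (rule finite_case) (use uni(1,2) that in auto)
  ultimately show ?thesis by blast
qed

end
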